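(* Let $i\in\{0,1\}$ and let $P=(\alpha,0)$ with $\alpha\in\{\pm1\}$. Then the family of irreducible integral binary cubic forms in $\mathcal Fv^{(i)}$ satisfying $f(P)=1$ exhibits (full) escape of mass, that is, $$\lim_{T\to\infty}\liminf_{X\to\infty}\frac{N_{P,T}^{(i)}(X)}{N_P^{(i)}(X)}=1 .$$
   Context: Forms and action: $V_{\mathbb R}$ is the space of real binary cubic forms $f(X,Y)=aX^3+bX^2Y+cXY^2+dY^3$, with $\mathrm{GL}_2(\mathbb R)$ acting by the twisted action $(g\cdot f)(X,Y)=\det(g)^{-1}f((X,Y)g)$, where $(X,Y)$ is a row vector. $\mathrm{Disc}(f)=b^2c^2-4ac^3-4b^3d-27a^2d^2+18abcd$. $V_{\mathbb R}^{(0)}$ (resp. $V_{\mathbb R}^{(1)}$) is the set of forms with $\mathrm{Disc}(f)>0$ (resp. $<0$); $V_{\mathbb Z}^{(i)}$ is the set of forms in $V_{\mathbb R}^{(i)}$ with integer coefficients $a,b,c,d$; $V_{\mathbb Z}^{(i),\mathrm{irr}}$ is the subset of forms irreducible over $\mathbb Q$. Fundamental domain: put $n(u)=\begin{pmatrix}1&0\\ u&1\end{pmatrix}$, $a(t)=\begin{pmatrix}t^{-1}&0\\0&t\end{pmatrix}$, $K=\mathrm{SO}_2(\mathbb R)$, $t_0=\sqrt[4]{3}/\sqrt2$; a scalar $\lambda>0$ stands for $\lambda I_2$. Gauss's usual fundamental domain for $\mathrm{GL}_2(\mathbb Z)\backslash\mathrm{GL}_2(\mathbb R)$ is $\mathcal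 F=\{n(u)a(t)k\lambda: u\in\nu(t),\ t\ge t_0,\ k\in K,\ \lambda>0\}$, where $\nu(t)\subset[-\frac12,\frac12]$ is a union of at most two intervals with $\nu(t)=[-\frac12,\frac12]$ for $t\ge1$ (explicitly, up to boundary, $\nu(t)=\{u\in[-\frac12,\frac12]:u^2+t^4\ge1\}$). For $T>t_0$, $\mathcal F_T=\{n(u)a(t)k\lambda\in\mathcal F:t>T\}$. Shape parameter: a real form $f=ax^3+bx^2y+cxy^2+dy^3$ of nonzero discriminant corresponds (Delone–Faddeev) to the cubic $\mathbb R$-algebra with basis $1,\omega,\theta$ and $\omega\theta=-ad$, $\omega^2=-ac+b\omega-a\theta$, $\theta^2=-bd+d\omega-c\theta$. If $\mathrm{Disc}(f)<0$ this algebra is $\mathbb R\oplus\mathbb C$; let $z_\omega,z_\theta$ be the images of $\omega,\theta$ in $(\mathbb R\oplus\mathbb C)/\mathbb R(1,1)\simeq\mathbb C$, with the complex embedding chosen so that $\Im(z_\theta/z_\omega)>0$, and $\tau_f=z_\theta/z_\omega$. If $\mathrm{Disc}(f)>0$, let $x^0=x-\mathrm{Tr}(x)/3$, $A_0=\mathrm{Tr}((\omega^0)^2)$, $B_0=\mathrm{Tr}(\omega^0\theta^0)$, $C_0=\mathrm{Tr}((\theta^0)^2)$, and $\tau_f=(B_0+\sqrt{-1}\sqrt{A_0C_0-B_0^2})/A_0$. For each $i\in\{0,1\}$ a base form $v^{(i)}\in V_{\mathbb R}^{(i)}$ with $\tau_{v^{(i)}}=\sqrt{-1}$ is fixed. Counts: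 $\mathcal Fv^{(i)}$ and $\mathcal F_Tv^{(i)}$ are multisets: a form $f$ is counted with multiplicity $\#\{g\in\mathcal F:g\cdot v^{(i)}=f\}$ (resp. $g\in\mathcal F_T$). Fix constants $0<c_-<c_+$. Define $N_P^{(i)}(X)=\#\{f\in\mathcal Fv^{(i)}\cap V_{\mathbb Z}^{(i),\mathrm{irr}}:f(P)=1,\ c_-X\le|\mathrm{Disc}(f)|<c_+X\}$ and $N_{P,T}^{(i)}(X)=\#\{f\in\mathcal F_Tv^{(i)}\cap V_{\mathbb Z}^{(i),\mathrm{irr}}:f(P)=1,\ c_-X\le|\mathrm{Disc}(f)|<c_+X\}$. *)

theory Defs
  imports
    "HOL-Analysis.Analysis"
    "HOL-Computational_Algebra.Polynomial"
begin

text \<open>\<open>Cubic a b c d\<close> is the form \<open>a X^3 + b X^2 Y + c X Y^2 + d Y^3\<close>.\<close>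

datatype 'a cubic = Cubic (cX3: 'a) (cX2Y: 'a) (cXY2: 'a) (cY3: 'a)

definition form_eval :: "real cubic \<Rightarrow> real^2 \<Rightarrow> real" where
  "form_eval f v = cX3 f * (v$1)^3 + cX2Y f * (v$1)^2 * v$2 + cXY2 f * v$1 * (v$2)^2 + cY3 f * (v$2)^3"

definition disc :: "real cubic \<Rightarrow> real" where
  "disc f = (case f of Cubic a b c d \<Rightarrow>
     b^2 * c^2 - 4 * a * c^3 - 4 * b^3 * d - 27 * a^2 * d^2 + 18 * a * b * c * d)"

text \<open>
  The twisted action, \<open>(g f)(X, Y) = f((X, Y) g) / det g\<close>, written out on coefficients;
  the lemmas \<open>form_eval_act\<close> and \<open>form_eval_inject\<close> below show that this formula
  characterises it.
\<close>

definition act :: "real^2^2 \<Rightarrow> real cubic \<Rightarrow> real cubic" where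
  "act g f = (case f of Cubic a b c d \<Rightarrow>
     (let p = g$1$1; q = g$1$2; r = g$2$1; s = g$2$2 in
      Cubic
       ((a * p^3 + b * p^2 * q + c * p * q^2 + d * q^3) / det g)
       ((3 * a * p^2 * r + b * (p^2 * s + 2 * p * q * r) + c * (q^2 * r + 2 * p * q * s) + 3 * d * q^2 * s) / det g)
       ((3 * a * p * r^2 + b * (q * r^2 + 2 * p * r * s) + c * (p * s^2 + 2 * q * r * s) + 3 * d * q * s^2) / det g)
       ((a * r^3 + b * r^2 * s + c * r * s^2 + d * s^3) / det g)))"

lemma form_eval_act: "form_eval (act g f) v = inverse (det g) * form_eval f (v v* g)"
proof (cases f)
  case (Cubic a b c d)
  define p q r s where "p = g$1$1" and "q = g$1$2" and "r = g$2$1" and "s = g$2$2"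
  define x y where "x = v$1" and "y = v$2"
  define e where "e = inverse (det g)"
  have 1: "(v v* g)$1 = p * x + r * y" "(v v* g)$2 = q * x + s * y"
    by (simp_all add: vector_matrix_mult_def sum_2 p_def q_def r_def s_def x_def y_def)
  have 2: "act g f = Cubic
       ((a * p^3 + b * p^2 * q + c * p * q^2 + d * q^3) * e)
       ((3 * a * p^2 * r + b * (p^2 * s + 2 * p * q * r) + c * (q^2 * r + 2 * p * q * s) + 3 * d * q^2 * s) * e)
       ((3 * a * p * r^2 + b * (q * r^2 + 2 * p * r * s) + c * (p * s^2 + 2 * q * r * s) + 3 * d * q * s^2) * e)
       ((a * r^3 + b * r^2 * s + c * r * s^2 + d * s^3) * e)"
    by (simp only: act_def Cubic cubic.case Let_def p_def q_def r_def s_def e_def divide_inverse)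
  show ?thesis
    unfolding form_eval_def 1 2
    unfolding Cubic cubic.sel e_def[symmetric] x_def[symmetric] y_def[symmetric]
    by algebra
qed

lemma form_eval_inject:
  assumes "\<And>v. form_eval f v = form_eval h v"
  shows "f = h"
proof (cases f, cases h)
  fix a b c d a' b' c' d'
  assume eqs: "f = Cubic a b c d" "h = Cubic a' b' c' d'"
  have "form_eval f (vector [x, y]) = form_eval h (vector [x, y])" for x y
    by (rule assms)
  from this[of 1 0] this[of 0 1] this[of 1 1] this[of 1 "-1"]
  show "f = h" by (simp add: eqs form_eval_def)
qed

text \<open>The form as an element of \<open>'a[Y][X]\<close>.\<close>

definition form_poly :: "'a::comm_semiring_1 cubic \<Rightarrow> 'a poly poly" where
  "form_poly f = [: [:0, 0, 0, cY3 f:], [:0, 0, cXY2 f:], [:0, cX2Y f:], [:cX3 f:] :]"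

lemma poly_form_poly: "poly (poly (form_poly f) [:x:]) y = form_eval f (vector [x, y])"
  by (simp add: form_poly_def form_eval_def algebra_simps power2_eq_square power3_eq_cube)

definition V_real :: "nat \<Rightarrow> real cubic set" where
  "V_real i = {f. (i = 0 \<and> disc f > 0) \<or> (i = 1 \<and> disc f < 0)}"

definition V_int :: "nat \<Rightarrow> real cubic set" where
  "V_int i = {f \<in> V_real i. {cX3 f, cX2Y f, cXY2 f, cY3 f} \<subseteq> \<int>}"

definition irreducible_over_rat :: "real cubic \<Rightarrow> bool" where
  "irreducible_over_rat f \<longleftrightarrow>
     (\<exists>q :: rat cubic. f = map_cubic of_rat q \<and> irreducible (form_poly q))"

definition V_int_irr :: "nat \<Rightarrow> real cubic set" where
  "V_int_irr i = {f \<in> V_int i. irreducible_over_rat f}"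

definition mat_n :: "real \<Rightarrow> real^2^2" where
  "mat_n u = vector [vector [1, 0], vector [u, 1]]"

definition mat_a :: "real \<Rightarrow> real^2^2" where
  "mat_a t = vector [vector [inverse t, 0], vector [0, t]]"

definition t0 :: real where
  "t0 = root 4 3 / sqrt 2"

text \<open>
  Gauss's domain is only pinned down up to its boundary. The predicate admits every
  convention for which boundary points of the slice at height \<open>t < 1\<close> are included.
\<close>

definition gauss_slices :: "(real \<Rightarrow> real set) \<Rightarrow> bool" where
  "gauss_slices \<nu> \<longleftrightarrow>
     (\<forall>t\<ge>t0. (\<exists>I J. is_interval I \<and> is_interval J \<and> \<nu> t = I \<union> J) \<and>
             {u. -1/2 < u \<and> u < 1/2 \<and> u^2 + t^4 > 1} \<subseteq> \<nu> t \<and>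
             \<nu> t \<subseteq> {u \<in> {-1/2..1/2}. u^2 + t^4 \<ge> 1}) \<and>
     (\<forall>t\<ge>1. \<nu> t = {-1/2..1/2})"

definition gauss_domain :: "(real \<Rightarrow> real set) \<Rightarrow> (real^2^2) set" where
  "gauss_domain \<nu> = {mat_n u ** mat_a t ** k ** mat l | u t k l.
     u \<in> \<nu> t \<and> t \<ge> t0 \<and> rotation_matrix k \<and> l > 0}"

definition gauss_domain_above :: "(real \<Rightarrow> real set) \<Rightarrow> real \<Rightarrow> (real^2^2) set" where
  "gauss_domain_above \<nu> T = {mat_n u ** mat_a t ** k ** mat l | u t k l.
     u \<in> \<nu> t \<and> t \<ge> t0 \<and> rotation_matrix k \<and> l > 0 \<and> t > T}"

text \<open>
  The Delone--Faddeev algebra of \<open>f\<close> on \<open>real^3\<close>, with coordinates in the basis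
  \<open>1, \<omega>, \<theta>\<close>.
\<close>

definition df_one :: "real^3" where "df_one = axis 1 1"
definition df_omega :: "real^3" where "df_omega = axis 2 1"
definition df_theta :: "real^3" where "df_theta = axis 3 1"

definition df_mult :: "real cubic \<Rightarrow> real^3 \<Rightarrow> real^3 \<Rightarrow> real^3" where
  "df_mult f x y = (case f of Cubic a b c d \<Rightarrow> vector
     [x$1 * y$1 - a * d * (x$2 * y$3 + x$3 * y$2) - a * c * (x$2 * y$2) - b * d * (x$3 * y$3),
      x$1 * y$2 + x$2 * y$1 + b * (x$2 * y$2) + d * (x$3 * y$3),
      x$1 * y$3 + x$3 * y$1 - a * (x$2 * y$2) - c * (x$3 * y$3)])"

lemma df_mult_table:
  fixes f a b c d
  defines "f \<equiv> Cubic a b c d"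
  shows "df_mult f df_one x = x" "df_mult f x df_one = x"
    "df_mult f df_omega df_theta = (- a * d) *\<^sub>R df_one"
    "df_mult f df_theta df_omega = (- a * d) *\<^sub>R df_one"
    "df_mult f df_omega df_omega = (- a * c) *\<^sub>R df_one + b *\<^sub>R df_omega - a *\<^sub>R df_theta"
    "df_mult f df_theta df_theta = (- b * d) *\<^sub>R df_one + d *\<^sub>R df_omega - c *\<^sub>R df_theta"
  by (simp_all add: f_def df_mult_def df_one_def df_omega_def df_theta_def axis_def
      vec_eq_iff forall_3)

definition df_trace :: "real cubic \<Rightarrow> real^3 \<Rightarrow> real" where
  "df_trace f x = trace (matrix (df_mult f x))"

definition df_trace0 :: "real cubic \<Rightarrow> real^3 \<Rightarrow> real^3" where
  "df_trace0 f x = x - (df_trace f x / 3) *\<^sub>R df_one"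

text \<open>\<open>\<real>\<close>-algebra isomorphisms onto \<open>\<real> \<oplus> \<complex>\<close>.\<close>

definition df_iso :: "real cubic \<Rightarrow> (real^3 \<Rightarrow> real \<times> complex) \<Rightarrow> bool" where
  "df_iso f \<phi> \<longleftrightarrow> linear \<phi> \<and> bij \<phi> \<and> \<phi> df_one = (1, 1) \<and>
     (\<forall>x y. \<phi> (df_mult f x y) = (fst (\<phi> x) * fst (\<phi> y), snd (\<phi> x) * snd (\<phi> y)))"

text \<open>
  The isomorphism of \<open>(\<real> \<oplus> \<complex>) / \<real>(1,1)\<close> with \<open>\<complex>\<close> that is the identity on the
  summand \<open>\<complex>\<close>.
\<close>

definition mod_diag :: "real \<times> complex \<Rightarrow> complex" where
  "mod_diag w = snd w - of_real (fst w)"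

text \<open>
  For negative discriminant the isomorphism \<open>\<phi>\<close> is unique up to complex conjugation, and
  the sign condition on the imaginary part singles out one of the two choices.
\<close>

definition shape :: "real cubic \<Rightarrow> complex" where
  "shape f =
     (if disc f < 0 then
        (THE \<tau>. \<exists>\<phi>. df_iso f \<phi> \<and> \<tau> = mod_diag (\<phi> df_theta) / mod_diag (\<phi> df_omega) \<and> Im \<tau> > 0)
      else
        (let w = df_trace0 f df_omega; h = df_trace0 f df_theta;
             A = df_trace f (df_mult f w w);
             B = df_trace f (df_mult f w h);
             C = df_trace f (df_mult f h h)
         in (of_real B + \<i> * of_real (sqrt (A * C - B^2))) / of_real A))"

definition orbit_mult :: "(real^2^2) set \<Rightarrow> real cubic \<Rightarrow> real cubic \<Rightarrow> nat" where
  "orbit_mult S v f = card {g \<in> S. act g v = f}"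

text \<open>
  Counts the irreducible integral forms of the multiset \<open>S v\<close>, with multiplicity. For \<open>S\<close>
  contained in Gauss's domain and \<open>disc v \<noteq> 0\<close> the index set of the sum and the
  multiplicities are finite: an irreducible form has nonzero \<open>X^3\<close>-coefficient, which bounds
  \<open>t\<close>, and stabilisers in \<open>GL(2, \<real>)\<close> are finite.
\<close>

definition form_count ::
  "(real^2^2) set \<Rightarrow> nat \<Rightarrow> real cubic \<Rightarrow> real^2 \<Rightarrow> real \<Rightarrow> real \<Rightarrow> real \<Rightarrow> nat" where
  "form_count S i v P cm cp X =
     (\<Sum>f \<in> {f \<in> (\<lambda>g. act g v) ` S \<inter> V_int_irr i.
              form_eval f P = 1 \<and> cm * X \<le> \<bar>disc f\<bar> \<and> \<bar>disc f\<bar> < cp * X}.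
        orbit_mult S v f)"

definition N_P ::
  "(real \<Rightarrow> real set) \<Rightarrow> nat \<Rightarrow> real cubic \<Rightarrow> real^2 \<Rightarrow> real \<Rightarrow> real \<Rightarrow> real \<Rightarrow> nat" where
  "N_P \<nu> i v P cm cp X = form_count (gauss_domain \<nu>) i v P cm cp X"

definition N_PT ::
  "(real \<Rightarrow> real set) \<Rightarrow> nat \<Rightarrow> real cubic \<Rightarrow> real^2 \<Rightarrow> real \<Rightarrow> real \<Rightarrow> real \<Rightarrow> real \<Rightarrow> nat" where
  "N_PT \<nu> i v P cm cp T X = form_count (gauss_domain_above \<nu> T) i v P cm cp X"

end

theory Submission
  imports Defs "HOL-Real_Asymp.Real_Asymp"
begin

text \<open>
  The shape condition forces \<open>v = Re (\<zeta>\<^sub>0 (X + \<i>Y)\<^sup>3)\<close> for positive and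
  \<open>v = |X + \<i>Y|\<^sup>2 Re (\<zeta>\<^sub>0 (X + \<i>Y))\<close> for negative discriminant, so the forms in the orbit are
  \<open>Re (\<zeta> (X + \<sigma>Y)\<^sup>3)\<close> and \<open>|X + \<sigma>Y|\<^sup>2 Re (\<zeta> (X + \<sigma>Y))\<close> with \<open>\<sigma> = u + \<i>t\<^sup>2\<close>, and their
  discriminant is a constant times \<open>|\<zeta>|\<^sup>4 t\<^bsup>12\<^esup>\<close>. When the leading coefficient is \<open>\<plusminus>1\<close> and \<open>t \<le> T\<close>,
  the other three coefficients are \<open>O\<^sub>T(X\<^bsup>1/4\<^esup>)\<close>, so these forms number only \<open>O\<^sub>T(X\<^bsup>3/4\<^esup>)\<close>.
  On the other hand an explicit family with \<open>b\<close> up to order \<open>X\<^bsup>1/6\<^esup>\<close>, \<open>c\<close> of order \<open>X\<^bsup>1/3\<^esup>\<close> and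
  \<open>d\<close> in an interval of length of order \<open>X\<^bsup>1/3\<^esup>\<close> near \<open>bc/9\<close> or \<open>bc\<close> contributes at least a
  constant times \<open>X\<^bsup>5/6\<^esup>\<close> forms to the total count. Hence for every fixed \<open>T\<close> the ratio already
  tends to 1 as the discriminant bound \<open>X\<close> grows.
\<close>

section \<open>Forms in the orbit of a base form\<close>

text \<open>Both \<open>z^3\<close> and \<open>z * norm z ^ 2\<close> have the form
  \<open>z\<^sup>2 * twist i z\<close>, so one computation of the action covers both signs of the
  discriminant.\<close>

definition twist :: "nat \<Rightarrow> complex \<Rightarrow> complex" where
  "twist i z = (if i = 0 then z else cnj z)"

text \<open>\<open>model i \<zeta> \<sigma>\<close> is the form \<open>Re (\<zeta> (X + \<sigma>Y)\<^sup>2 (X + twist i \<sigma> Y))\<close>.\<close>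

definition model :: "nat \<Rightarrow> complex \<Rightarrow> complex \<Rightarrow> real cubic" where
  "model i \<zeta> \<sigma> = Cubic (Re \<zeta>) (Re (\<zeta> * (2 * \<sigma> + twist i \<sigma>)))
     (Re (\<zeta> * (\<sigma>\<^sup>2 + 2 * \<sigma> * twist i \<sigma>))) (Re (\<zeta> * \<sigma>\<^sup>2 * twist i \<sigma>))"

text \<open>On row vectors \<open>(x, y)\<close>, right multiplication by this matrix is
  multiplication of \<open>x + \<i> y\<close> by \<open>e\<close>.\<close>

definition rot :: "complex \<Rightarrow> real^2^2" where
  "rot e = vector [vector [Re e, Im e], vector [- Im e, Re e]]"

lemma twist_simps [simp]:
  "twist i (z + w) = twist i z + twist i w" "twist i (z * w) = twist i z * twist i w"
  "twist i (of_real x) = of_real x" "norm (twist i z) = norm z"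
  by (auto simp: twist_def)

lemma Re_of_real_mult: "Re (of_real r * z) = r * Re z"
  by simp

lemma form_eval_model:
  "form_eval (model i \<zeta> \<sigma>) v =
     Re (\<zeta> * (of_real (v$1) + \<sigma> * of_real (v$2))\<^sup>2 * twist i (of_real (v$1) + \<sigma> * of_real (v$2)))"
proof -
  define x y :: real where "x = v$1" and "y = v$2"
  have "form_eval (model i \<zeta> \<sigma>) v = Re (\<zeta> * of_real (x^3) + \<zeta> * (2 * \<sigma> + twist i \<sigma>) * of_real (x\<^sup>2 * y)
      + \<zeta> * (\<sigma>\<^sup>2 + 2 * \<sigma> * twist i \<sigma>) * of_real (x * y\<^sup>2) + \<zeta> * \<sigma>\<^sup>2 * twist i \<sigma> * of_real (y^3))"
    unfolding x_def y_def form_eval_def model_def plus_complex.sel cubic.sel mult.commute[of _ "complex_of_real _"]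
      Re_of_real_mult by (simp add: mult_ac del: times_complex.sel)
  also have "\<zeta> * of_real (x^3) + \<zeta> * (2 * \<sigma> + twist i \<sigma>) * of_real (x\<^sup>2 * y)
      + \<zeta> * (\<sigma>\<^sup>2 + 2 * \<sigma> * twist i \<sigma>) * of_real (x * y\<^sup>2) + \<zeta> * \<sigma>\<^sup>2 * twist i \<sigma> * of_real (y^3)
      = \<zeta> * (of_real x + \<sigma> * of_real y)\<^sup>2 * (of_real x + twist i \<sigma> * of_real y)"
    unfolding of_real_mult of_real_power by algebra
  finally show ?thesis by (simp add: x_def y_def)
qed

lemma gauss_matrix_nth:
  assumes "t > 0"
  shows "(mat_n u ** mat_a t ** rot e ** mat l)$1$1 = l * Re e / t"
    "(mat_n u ** mat_a t ** rot e ** mat l)$1$2 = l * Im e / t"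
    "(mat_n u ** mat_a t ** rot e ** mat l)$2$1 = l * (u * Re e / t - t * Im e)"
    "(mat_n u ** mat_a t ** rot e ** mat l)$2$2 = l * (u * Im e / t + t * Re e)"
  using assms
  by (simp_all add: mat_n_def mat_a_def rot_def matrix_matrix_mult_def sum_2 mat_def field_simps)

text \<open>Right multiplication by the matrix turns \<open>x + \<i> y\<close> into
  \<open>(l / t) e (x + \<sigma> y)\<close> with \<open>\<sigma> = u + \<i> t\<^sup>2\<close>.
  Homogeneity of degree three and the determinant \<open>l\<^sup>2\<close> leave the scalar
  \<open>(l / t)^3 / l\<^sup>2 = l / t^3\<close>.\<close>

lemma act_model:
  assumes t: "t > 0" and l: "l > 0" and e: "norm e = 1"
  shows "act (mat_n u ** mat_a t ** rot e ** mat l) (model i \<zeta> \<i>)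
    = model i (of_real (l / t^3) * \<zeta> * (e\<^sup>2 * twist i e)) (Complex u (t\<^sup>2))"
proof (rule form_eval_inject)
  fix v :: "real^2"
  let ?g = "mat_n u ** mat_a t ** rot e ** mat l"
  define z where "z = of_real (v$1) + Complex u (t\<^sup>2) * of_real (v$2)"
  have e2: "(Re e)\<^sup>2 + (Im e)\<^sup>2 = 1" using e by (simp add: norm_complex_def)
  have "det ?g = l\<^sup>2 * ((Re e)\<^sup>2 + (Im e)\<^sup>2)"
    unfolding det_2 gauss_matrix_nth[OF t] using t
    by (simp add: field_simps power2_eq_square)
  hence det: "det ?g = l\<^sup>2" by (simp add: e2)
  have 1: "(v v* ?g)$1 = l / t * Re (e * z)" "(v v* ?g)$2 = l / t * Im (e * z)"
    using t by (simp_all add: vector_matrix_mult_def sum_2 gauss_matrix_nth[OF t] z_def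
        field_simps power2_eq_square)
  have 2: "of_real ((v v* ?g)$1) + \<i> * of_real ((v v* ?g)$2) = of_real (l / t) * (e * z)"
    unfolding 1 by (simp add: complex_eq_iff)
  have "form_eval (act ?g (model i \<zeta> \<i>)) v
      = Re (\<zeta> * (of_real (l / t) * (e * z))\<^sup>2 * twist i (of_real (l / t) * (e * z))) / l\<^sup>2"
    unfolding form_eval_act form_eval_model 2 det by (simp add: field_simps)
  also have "\<zeta> * (of_real (l / t) * (e * z))\<^sup>2 * twist i (of_real (l / t) * (e * z)) =
      of_real ((l / t)^3) * (\<zeta> * (e\<^sup>2 * twist i e) * z\<^sup>2 * twist i z)"
    unfolding twist_simps of_real_power by algebra
  also have "Re \<dots> / l\<^sup>2 = l / t^3 * Re (\<zeta> * (e\<^sup>2 * twist i e) * z\<^sup>2 * twist i z)"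
    unfolding Re_of_real_mult using l
    by (simp add: field_simps power2_eq_square power3_eq_cube del: times_complex.sel)
  also have "\<dots> = form_eval (model i (of_real (l / t^3) * \<zeta> * (e\<^sup>2 * twist i e)) (Complex u (t\<^sup>2))) v"
    unfolding form_eval_model z_def[symmetric] mult.assoc by (simp del: of_real_divide of_real_power)
  finally show "form_eval (act ?g (model i \<zeta> \<i>)) v = \<dots>" .
qed

lemma rotation_matrix_rot:
  fixes k :: "real^2^2"
  assumes "rotation_matrix k"
  obtains e where "norm e = 1" "k = rot e"
proof -
  define p q r s where "p = k$1$1" and "q = k$1$2" and "r = k$2$1" and "s = k$2$2"
  have "det k = 1" "transpose k ** k = mat 1"
    using assms by (auto simp: rotation_matrix_def orthogonal_matrix)
  moreover have "k ** transpose k = mat 1"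
    using assms by (auto simp: rotation_matrix_def orthogonal_matrix_def)
  ultimately have *: "p * s - q * r = 1" "p * p + q * q = 1" "r * r + s * s = 1" "p * r + q * s = 0"
    by (auto simp: det_2 p_def q_def r_def s_def matrix_matrix_mult_def transpose_def mat_def
        sum_2 vec_eq_iff forall_2)
  have "s = p" "r = - q" using * by algebra+
  hence "k = rot (Complex p q)"
    by (simp add: rot_def vec_eq_iff forall_2 p_def q_def r_def s_def)
  moreover have "norm (Complex p q) = 1"
    using * by (simp add: norm_complex_def power2_eq_square)
  ultimately show ?thesis using that by blast
qed

lemma rotation_matrix_rotI:
  assumes "norm e = 1" shows "rotation_matrix (rot e)"
proof -
  have "(Re e)\<^sup>2 + (Im e)\<^sup>2 = 1" using assms by (simp add: norm_complex_def)
  thus ?thesis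
    by (simp add: rotation_matrix_def orthogonal_matrix rot_def det_2 matrix_matrix_mult_def
        transpose_def mat_def sum_2 vec_eq_iff forall_2 power2_eq_square mult.commute add.commute)
qed

text \<open>Used to translate bounds on the discriminant into bounds on
  \<open>norm \<zeta> ^ 4 * Im \<sigma> ^ 6\<close>.\<close>

lemma disc_model:
  "disc (model i \<zeta> \<sigma>) = (if i = 0 then 108 else -4) * norm \<zeta> ^ 4 * Im \<sigma> ^ 6"
proof -
  define p q u w where "p = Re \<zeta>" and "q = Im \<zeta>" and "u = Re \<sigma>" and "w = Im \<sigma>"
  have eqs: "\<zeta> = Complex p q" "\<sigma> = Complex u w" by (simp_all add: p_def q_def u_def w_def)
  have n: "norm \<zeta> ^ 4 = (p^2 + q^2)^2"
    using power_mult[of "norm \<zeta>" 2 2] by (simp add: eqs cmod_power2)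
  show ?thesis
  proof (cases "i = 0")
    case True
    have "model i \<zeta> \<sigma> = Cubic p (3 * (p * u - q * w)) (3 * (p * (u\<^sup>2 - w\<^sup>2) - 2 * q * u * w))
        (p * (u^3 - 3 * u * w\<^sup>2) - q * (3 * u\<^sup>2 * w - w^3))"
      using True by (simp add: model_def eqs twist_def algebra_simps power2_eq_square power3_eq_cube)
    moreover have "disc (Cubic p (3 * (p * u - q * w)) (3 * (p * (u\<^sup>2 - w\<^sup>2) - 2 * q * u * w))
        (p * (u^3 - 3 * u * w\<^sup>2) - q * (3 * u\<^sup>2 * w - w^3))) = 108 * (p\<^sup>2 + q\<^sup>2)\<^sup>2 * w^6"
      unfolding disc_def cubic.case by algebra
    ultimately show ?thesis using True by (simp only: n w_def simp_thms if_True)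
  next
    case False
    have "model i \<zeta> \<sigma> = Cubic p (3 * p * u - q * w) (p * (3 * u\<^sup>2 + w\<^sup>2) - 2 * q * u * w)
        ((p * u - q * w) * (u\<^sup>2 + w\<^sup>2))"
      using False by (simp add: model_def eqs twist_def algebra_simps power2_eq_square power3_eq_cube)
    moreover have "disc (Cubic p (3 * p * u - q * w) (p * (3 * u\<^sup>2 + w\<^sup>2) - 2 * q * u * w)
        ((p * u - q * w) * (u\<^sup>2 + w\<^sup>2))) = -4 * (p\<^sup>2 + q\<^sup>2)\<^sup>2 * w^6"
      unfolding disc_def cubic.case by algebra
    ultimately show ?thesis using False by (simp only: n w_def simp_thms if_False)
  qed
qed

section \<open>Base forms of shape \<open>\<i>\<close>\<close>

lemma df_trace_Cubic: "df_trace (Cubic a b c d) x = 3 * x$1 + b * x$2 - c * x$3"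
  by (simp add: df_trace_def trace_def matrix_def df_mult_def sum_3 axis_def)

text \<open>The trace form \<open>A X\<^sup>2 + 2 B X Y + C Y\<^sup>2\<close> is
  \<open>2 / 3\<close> times the Hessian. Shape \<open>\<i>\<close> makes it a nonzero multiple of
  \<open>X\<^sup>2 + Y\<^sup>2\<close>, and \<open>B = 0\<close>, \<open>A = C\<close> then force
  the two linear relations.\<close>

lemma shape_pos_disc:
  fixes a b c d :: real
  assumes "disc (Cubic a b c d) > 0" "shape (Cubic a b c d) = \<i>"
  shows "c = -3 * a" "b = -3 * d"
proof -
  let ?f = "Cubic a b c d"
  define w h where "w = df_trace0 ?f df_omega" and "h = df_trace0 ?f df_theta"
  define A B C where "A = df_trace ?f (df_mult ?f w w)" and "B = df_trace ?f (df_mult ?f w h)"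
    and "C = df_trace ?f (df_mult ?f h h)"
  have w: "w$1 = - b / 3" "w$2 = 1" "w$3 = 0" and h: "h$1 = c / 3" "h$2 = 0" "h$3 = 1"
    by (simp_all add: w_def h_def df_trace0_def df_trace_Cubic df_omega_def df_theta_def
        df_one_def axis_def)
  have A: "A = 2 / 3 * (b\<^sup>2 - 3 * a * c)" and C: "C = 2 / 3 * (c\<^sup>2 - 3 * b * d)"
    by (simp_all add: A_def C_def df_trace_Cubic df_mult_def w h field_simps power2_eq_square)
  have B: "B = (b * c - 9 * a * d) / 3"
    by (simp add: B_def df_trace_Cubic df_mult_def w h field_simps power2_eq_square)
  have "(of_real B + \<i> * of_real (sqrt (A * C - B\<^sup>2))) / of_real A = \<i>"
    using assms by (simp add: shape_def Let_def A_def B_def C_def w_def h_def)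
  \<comment> \<open>Division by zero yields \<open>0\<close>, which differs from
    \<open>\<i>\<close>.\<close>
  moreover from this have "A \<noteq> 0" by auto
  ultimately have "of_real B + \<i> * of_real (sqrt (A * C - B\<^sup>2)) = \<i> * of_real A"
    by (simp add: field_simps)
  from arg_cong[OF this, of Re] arg_cong[OF this, of Im]
  have BA: "B = 0 \<and> sqrt (A * C - B\<^sup>2) = A" by simp
  hence "B = 0" ..
  have "disc (Cubic a b c d) = 3 * (A * C - B\<^sup>2)"
    unfolding disc_def cubic.case A B C by (simp add: field_simps) algebra
  hence "A * C - B\<^sup>2 > 0" using assms(1) by simp
  hence "(sqrt (A * C - B\<^sup>2))\<^sup>2 = A * C - B\<^sup>2" by simp
  hence "A\<^sup>2 = A * C" unfolding conjunct2[OF BA] using \<open>B = 0\<close> by simp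
  hence "C = A" using \<open>A \<noteq> 0\<close> by (simp add: power2_eq_square)
  have "(c + 3 * a) * A = 0" "(b + 3 * d) * A = 0"
    using \<open>B = 0\<close> \<open>C = A\<close> unfolding A B C by algebra+
  thus "c = -3 * a" "b = -3 * d" using \<open>A \<noteq> 0\<close> by auto
qed

section \<open>Negative discriminant: embeddings of the algebra and roots of the form\<close>

text \<open>The equation says that the form vanishes at \<open>(\<tau>, -1)\<close>. It follows from
  comparing the multiplication table in the real and in the complex component.\<close>

lemma df_iso_root:
  fixes a b c d :: real
  assumes iso: "df_iso (Cubic a b c d) \<phi>"
    and \<tau>: "\<tau> = mod_diag (\<phi> df_theta) / mod_diag (\<phi> df_omega)" "Im \<tau> > 0"
  shows "of_real a * \<tau>^3 - of_real b * \<tau>\<^sup>2 + of_real c * \<tau> - of_real d = 0"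
proof -
  let ?f = "Cubic a b c d"
  define w w1 h h1 where "w = snd (\<phi> df_omega)" and "w1 = complex_of_real (fst (\<phi> df_omega))"
    and "h = snd (\<phi> df_theta)" and "h1 = complex_of_real (fst (\<phi> df_theta))"
  have lin: "linear \<phi>" and one: "\<phi> df_one = (1, 1)"
    and mult: "\<And>x y. \<phi> (df_mult ?f x y) = (fst (\<phi> x) * fst (\<phi> y), snd (\<phi> x) * snd (\<phi> y))"
    using iso by (auto simp: df_iso_def)
  have phi: "\<phi> (x *\<^sub>R df_one) = (x, of_real x)"
    "\<phi> (x *\<^sub>R df_one + y *\<^sub>R df_omega - z *\<^sub>R df_theta) =
      (x + y * fst (\<phi> df_omega) - z * fst (\<phi> df_theta), of_real x + of_real y * w - of_real z * h)"
    for x y z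
    by (simp_all add: linear_diff[OF lin] linear_add[OF lin] linear_cmul[OF lin] one prod_eq_iff
        w_def h_def scaleR_conv_of_real[where 'a=complex])
  have e: "w * h = - of_real a * of_real d"
    "w * w = - of_real a * of_real c + of_real b * w - of_real a * h"
    "h * h = - of_real b * of_real d + of_real d * w - of_real c * h"
    using mult[of df_omega df_theta] mult[of df_omega df_omega] mult[of df_theta df_theta]
    unfolding df_mult_table phi w_def[symmetric] h_def[symmetric] by simp_all
  have "fst (\<phi> df_omega) * fst (\<phi> df_theta) = - a * d"
    "fst (\<phi> df_omega) * fst (\<phi> df_omega) = - a * c + b * fst (\<phi> df_omega) - a * fst (\<phi> df_theta)"
    "fst (\<phi> df_theta) * fst (\<phi> df_theta) = - b * d + d * fst (\<phi> df_omega) - c * fst (\<phi> df_theta)"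
    using mult[of df_omega df_theta] mult[of df_omega df_omega] mult[of df_theta df_theta]
    unfolding df_mult_table phi by simp_all
  from this[THEN arg_cong[of _ _ complex_of_real]]
  have e1: "w1 * h1 = - of_real a * of_real d"
    "w1 * w1 = - of_real a * of_real c + of_real b * w1 - of_real a * h1"
    "h1 * h1 = - of_real b * of_real d + of_real d * w1 - of_real c * h1"
    unfolding w1_def h1_def by simp_all
  text \<open>Subtracting the real relations from the complex ones leaves multiples of \<open>D\<close>.\<close>
  define D where "D = w - w1"
  have "D \<noteq> 0" using \<tau> by (auto simp: mod_diag_def D_def w_def w1_def)
  have h: "h = h1 + \<tau> * D" using \<tau>(1) \<open>D \<noteq> 0\<close>
    by (simp add: mod_diag_def D_def w_def w1_def h_def h1_def)
  have w: "w = w1 + D" by (simp add: D_def)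
  have "D * (w1 * \<tau> + h1 + \<tau> * D) = 0" "D * (D + 2 * w1 - (of_real b - of_real a * \<tau>)) = 0"
    "D * (\<tau>\<^sup>2 * D + 2 * h1 * \<tau> - (of_real d - of_real c * \<tau>)) = 0"
    using e e1 unfolding h w by algebra+
  hence "w1 * \<tau> + h1 + \<tau> * D = 0" "D + 2 * w1 - (of_real b - of_real a * \<tau>) = 0"
    "\<tau>\<^sup>2 * D + 2 * h1 * \<tau> - (of_real d - of_real c * \<tau>) = 0"
    using \<open>D \<noteq> 0\<close> by auto
  \<comment> \<open>Twice \<open>\<tau>\<close> times the first relation, minus the third, minus
    \<open>\<tau>\<^sup>2\<close> times the second eliminates \<open>w1\<close>, \<open>h1\<close>
    and \<open>D\<close>.\<close>
  thus ?thesis by algebra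
qed

text \<open>Two distinct roots in the upper half plane would give, with their conjugates, four roots
  of a nonzero polynomial of degree at most three.\<close>

lemma real_cubic_upper_root_unique:
  fixes a b c d :: real
  assumes r: "of_real a * \<tau>^3 - of_real b * \<tau>\<^sup>2 + of_real c * \<tau> - of_real d = 0" "Im \<tau> > 0"
    and r': "of_real a * \<tau>'^3 - of_real b * \<tau>'\<^sup>2 + of_real c * \<tau>' - of_real d = 0" "Im \<tau>' > 0"
    and nz: "Cubic a b c d \<noteq> Cubic 0 0 0 0"
  shows "\<tau> = \<tau>'"
proof (rule ccontr)
  assume ne: "\<tau> \<noteq> \<tau>'"
  define p where "p = [: - of_real d, of_real c, - of_real b, complex_of_real a :]"
  have p0: "p \<noteq> 0" using nz by (auto simp: p_def)
  have cnj_root: "poly p (cnj z) = 0" if "poly p z = 0" for z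
  proof -
    have "poly p (cnj z) = cnj (poly p z)" by (simp add: p_def)
    thus ?thesis using that by simp
  qed
  have "poly p \<tau> = 0" "poly p \<tau>' = 0"
    using r(1) r'(1) by (simp_all add: p_def algebra_simps power2_eq_square power3_eq_cube)
  hence sub: "{\<tau>, \<tau>', cnj \<tau>, cnj \<tau>'} \<subseteq> {z. poly p z = 0}" using cnj_root by auto
  have "\<tau> \<noteq> cnj \<tau>'" "\<tau>' \<noteq> cnj \<tau>" "\<tau> \<noteq> cnj \<tau>" "\<tau>' \<noteq> cnj \<tau>'" using r(2) r'(2)
    by (auto simp: complex_eq_iff)
  hence "card {\<tau>, \<tau>', cnj \<tau>, cnj \<tau>'} = 4" using ne by auto
  moreover have "card {\<tau>, \<tau>', cnj \<tau>, cnj \<tau>'} \<le> card {z. poly p z = 0}"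
    by (rule card_mono[OF poly_roots_finite[OF p0] sub])
  moreover have "card {z. poly p z = 0} \<le> degree p" by (rule card_poly_roots_bound[OF p0])
  moreover have "degree p \<le> 3" by (simp add: p_def)
  ultimately show False by simp
qed

text \<open>The equations express the factorisation
  \<open>(l X + m Y) (A X\<^sup>2 + B X Y + C Y\<^sup>2)\<close>. The linear factor is
  \<open>Y\<close> if \<open>a = 0\<close>, and otherwise comes from a real root found by the
  intermediate value theorem.\<close>

lemma cubic_real_factor:
  fixes a b c d :: real
  obtains l m A B C where "a = l * A" "b = l * B + m * A" "c = l * C + m * B" "d = m * C"
proof (cases "a = 0")
  case True
  thus ?thesis using that[of 0 b c 1 d] by simp
next
  case False
  obtain r where r: "a * r^3 + b * r\<^sup>2 + c * r + d = 0"
  proof -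
    \<comment> \<open>Reflecting \<open>p\<close> to \<open>q\<close> lets the behaviour at plus
      infinity also settle the sign of \<open>p\<close> at minus infinity.\<close>
    define p q where "p = [: d / a, c / a, b / a, 1 :]" and "q = [: - d / a, c / a, - b / a, 1 :]"
    have pq: "poly q x = - poly p (- x)" for x
      by (simp add: p_def q_def algebra_simps)
    obtain M where M: "\<And>x. x \<ge> M \<Longrightarrow> poly p x \<ge> 1"
      using poly_pinfty_gt_lc[of p] by (auto simp: p_def)
    obtain N where N: "\<And>x. x \<ge> N \<Longrightarrow> poly q x \<ge> 1"
      using poly_pinfty_gt_lc[of q] by (auto simp: q_def)
    define K where "K = max 1 (max M N)"
    have "M \<le> K" "N \<le> K" by (simp_all add: K_def)
    have "\<exists>r>- K. r < K \<and> poly p r = 0"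
    proof (rule poly_IVT_pos)
      show "poly p (- K) < 0" using N[OF \<open>N \<le> K\<close>] by (simp add: pq)
      show "0 < poly p K" using M[OF \<open>M \<le> K\<close>] by simp
    qed (simp add: K_def)
    then obtain r where "poly p r = 0" by blast
    hence "a * r^3 + b * r\<^sup>2 + c * r + d = 0" using False
      by (simp add: p_def field_simps power2_eq_square power3_eq_cube)
    thus ?thesis using that by blast
  qed
  have "d = - r * (c + r * (b + r * a))" using r by algebra
  thus ?thesis using that[of 1 a "b + r * a" "- r" "c + r * (b + r * a)"] by (simp add: algebra_simps)
qed

text \<open>Supplies the existence half for the definite description in \<open>shape\<close>: the
  linear factor gives the map to the reals, a root \<open>\<rho>\<close> of the quadratic factor the
  map to the complex numbers.\<close>

lemma df_iso_exists:
  fixes a b c d :: real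
  assumes "disc (Cubic a b c d) < 0"
  shows "\<exists>\<phi>. df_iso (Cubic a b c d) \<phi> \<and> Im (mod_diag (\<phi> df_theta) / mod_diag (\<phi> df_omega)) > 0"
proof -
  obtain l m A B C where abcd: "a = l * A" "b = l * B + m * A" "c = l * C + m * B" "d = m * C"
    by (rule cubic_real_factor)
  define R where "R = A * m\<^sup>2 - B * l * m + C * l\<^sup>2"
  \<comment> \<open>\<open>R\<close> is the resultant of the two factors, so the quadratic factor is
    definite and prime to the linear one.\<close>
  have "disc (Cubic a b c d) = (B\<^sup>2 - 4 * A * C) * R\<^sup>2"
    unfolding disc_def cubic.case abcd R_def by algebra
  hence neg: "B\<^sup>2 - 4 * A * C < 0" and R: "R \<noteq> 0"
    using assms by (auto simp: mult_less_0_iff)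
  have A: "A \<noteq> 0" using neg by auto
  define \<rho> where "\<rho> = Complex (- B / (2 * A)) (sqrt (4 * A * C - B\<^sup>2) / (2 * \<bar>A\<bar>))"
  have Im: "Im \<rho> > 0" using neg A by (simp add: \<rho>_def)
  have root: "of_real A * \<rho>\<^sup>2 + of_real B * \<rho> + of_real C = 0"
  proof -
    have 1: "(sqrt (4 * A * C - B\<^sup>2) / (2 * \<bar>A\<bar>))\<^sup>2 = (4 * A * C - B\<^sup>2) / (4 * A\<^sup>2)"
      using neg by (simp add: power_divide power_mult_distrib)
    have "Re (\<rho>\<^sup>2) = (- B / (2 * A))\<^sup>2 - (4 * A * C - B\<^sup>2) / (4 * A\<^sup>2)"
      unfolding 1[symmetric] by (simp add: \<rho>_def power2_eq_square)
    moreover have "Im (\<rho>\<^sup>2) = - B / A * Im \<rho>"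
      by (simp add: \<rho>_def power2_eq_square)
    ultimately show ?thesis using A
      by (simp add: complex_eq_iff \<rho>_def field_simps power2_eq_square)
  qed
  \<comment> \<open>In both components the images of \<open>\<omega>\<close> and
    \<open>\<theta>\<close> must have product \<open>- a * d\<close>; in the complex one this uses
    \<open>A \<rho>\<^sup>2 + B \<rho> = - C\<close>.\<close>
  define \<phi> :: "real^3 \<Rightarrow> real \<times> complex" where
    "\<phi> = (\<lambda>x. (x$1 + x$2 * (A * m) - x$3 * (l * C),
       of_real (x$1) - of_real (x$2) * (of_real (l * A) * \<rho>) - of_real (x$3) * (of_real m * (of_real A * \<rho> + of_real B))))"
  have lin: "linear \<phi>"
    by (rule linearI) (auto simp: \<phi>_def algebra_simps scaleR_conv_of_real[where 'a=complex])
  have "x = 0" if "\<phi> x = 0" for x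
  proof -
    have "(x$2 * l + x$3 * m) * A * Im \<rho> = 0"
      using arg_cong[OF that, of "\<lambda>z. Im (snd z)"] by (simp add: \<phi>_def algebra_simps)
    hence 1: "x$2 * l + x$3 * m = 0" using A Im by simp
    have "x$1 - (x$2 * l + x$3 * m) * A * Re \<rho> - x$3 * m * B = 0"
      using arg_cong[OF that, of "\<lambda>z. Re (snd z)"] by (simp add: \<phi>_def algebra_simps)
    hence 2: "x$1 = x$3 * m * B" unfolding 1 by simp
    have 3: "x$1 + x$2 * (A * m) - x$3 * (l * C) = 0"
      using arg_cong[OF that, of fst] by (simp add: \<phi>_def)
    \<comment> \<open>The remaining linear system in \<open>x$2\<close> and \<open>x$3\<close> has
      determinant \<open>- R\<close>.\<close>
    have "x$2 * R = 0" "x$3 * R = 0" using 1 3 unfolding 2 R_def by algebra+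
    hence "x$2 = 0" "x$3 = 0" using R by auto
    thus "x = 0" using 2 by (simp add: vec_eq_iff forall_3)
  qed
  hence inj: "inj \<phi>" using linear_injective_0[OF lin] by blast
  have bij: "bij \<phi>"
  proof -
    have "surj \<phi>" by (rule linear_injective_imp_surjective[OF lin inj]) simp
    thus ?thesis using inj by (simp add: bij_def)
  qed
  have mult: "\<phi> (df_mult (Cubic a b c d) x y) = (fst (\<phi> x) * fst (\<phi> y), snd (\<phi> x) * snd (\<phi> y))" for x y
  proof -
    have 1: "fst (\<phi> (df_mult (Cubic a b c d) x y)) = fst (\<phi> x) * fst (\<phi> y)"
      unfolding \<phi>_def abcd by (simp add: df_mult_def) algebra
    have "snd (\<phi> (df_mult (Cubic a b c d) x y)) = snd (\<phi> x) * snd (\<phi> y)"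
      unfolding \<phi>_def abcd using root by (simp add: df_mult_def) algebra
    thus ?thesis using 1 by (simp add: prod_eq_iff)
  qed
  have iso: "df_iso (Cubic a b c d) \<phi>"
    unfolding df_iso_def using lin bij mult by (simp add: \<phi>_def df_one_def axis_def)
  have ne: "of_real l * \<rho> + of_real m \<noteq> 0"
  proof
    assume *: "of_real l * \<rho> + of_real m = 0"
    from arg_cong[OF *, of Im] Im have "l = 0" by simp
    with * R show False by (simp add: R_def)
  qed
  have "mod_diag (\<phi> df_omega) = - of_real A * (of_real l * \<rho> + of_real m)"
    "mod_diag (\<phi> df_theta) = of_real l * of_real C - of_real m * (of_real A * \<rho> + of_real B)"
    by (simp_all add: mod_diag_def \<phi>_def df_omega_def df_theta_def axis_def algebra_simps)
  \<comment> \<open>The equation of \<open>\<rho>\<close> lets \<open>l \<rho> + m\<close> cancel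
    from the ratio, which becomes a real translate of \<open>\<rho>\<close> and stays in the upper
    half plane.\<close>
  moreover have "of_real l * of_real C - of_real m * (of_real A * \<rho> + of_real B) =
      - of_real A * (of_real l * \<rho> + of_real m) * (\<rho> + of_real (B / A))"
  proof -
    have "complex_of_real B = of_real A * of_real (B / A)" using A by simp
    thus ?thesis using root by algebra
  qed
  ultimately have "mod_diag (\<phi> df_theta) / mod_diag (\<phi> df_omega) = \<rho> + of_real (B / A)"
    using ne A by simp
  hence "Im (mod_diag (\<phi> df_theta) / mod_diag (\<phi> df_omega)) > 0" using Im by simp
  thus ?thesis using iso by blast
qed

text \<open>The ratio in the upper half plane exists and is unique, so the definite description
  really is attained. Hence the form vanishes at \<open>(\<i>, -1)\<close>, and real and imaginary
  parts give the two relations.\<close>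

lemma shape_neg_disc:
  fixes a b c d :: real
  assumes neg: "disc (Cubic a b c d) < 0" and shape: "shape (Cubic a b c d) = \<i>"
  shows "c = a" "d = b"
proof -
  let ?P = "\<lambda>\<tau>. \<exists>\<phi>. df_iso (Cubic a b c d) \<phi> \<and>
      \<tau> = mod_diag (\<phi> df_theta) / mod_diag (\<phi> df_omega) \<and> Im \<tau> > 0"
  have nz: "Cubic a b c d \<noteq> Cubic 0 0 0 0" using neg by (auto simp: disc_def)
  have "\<exists>!\<tau>. ?P \<tau>"
  proof (rule ex_ex1I)
    show "\<exists>\<tau>. ?P \<tau>" using df_iso_exists[OF neg] by blast
  next
    fix \<tau> \<tau>' assume "?P \<tau>" "?P \<tau>'"
    thus "\<tau> = \<tau>'" using df_iso_root real_cubic_upper_root_unique[OF _ _ _ _ nz] by metis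
  qed
  hence "?P (THE \<tau>. ?P \<tau>)" by (rule theI')
  moreover have "(THE \<tau>. ?P \<tau>) = \<i>" using shape neg by (simp add: shape_def)
  ultimately have "?P \<i>" by simp
  hence "of_real a * \<i>^3 - of_real b * \<i>\<^sup>2 + of_real c * \<i> - of_real d = 0"
    using df_iso_root by blast
  thus "c = a" "d = b" by (auto simp: complex_eq_iff power3_eq_cube)
qed

lemma base_form_model:
  assumes "i \<in> {0, 1}" "v \<in> V_real i" "shape v = \<i>"
  obtains \<zeta> where "\<zeta> \<noteq> 0" "v = model i \<zeta> \<i>"
proof -
  obtain a b c d where v: "v = Cubic a b c d" by (cases v)
  have "disc v \<noteq> 0" using assms(2) by (auto simp: V_real_def)
  have "\<exists>\<zeta>. v = model i \<zeta> \<i>"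
  proof (cases "i = 0")
    case True
    hence "disc v > 0" using assms(2) by (simp add: V_real_def)
    from shape_pos_disc[OF this[unfolded v] assms(3)[unfolded v]]
    have "v = model i (Complex a d) \<i>" using True
      by (simp add: v model_def twist_def power2_eq_square)
    thus ?thesis ..
  next
    case False
    hence "disc v < 0" using assms(2) by (simp add: V_real_def)
    from shape_neg_disc[OF this[unfolded v] assms(3)[unfolded v]]
    have "v = model i (Complex a (- b)) \<i>" using False
      by (simp add: v model_def twist_def power2_eq_square)
    thus ?thesis ..
  qed
  then obtain \<zeta> where "v = model i \<zeta> \<i>" ..
  moreover from this have "\<zeta> \<noteq> 0" using \<open>disc v \<noteq> 0\<close> by (auto simp: disc_model)
  ultimately show ?thesis using that by blast
qed

section \<open>Multiplicities and forms of bounded height\<close>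

lemma model_components:
  "model i (Complex p q) (Complex u w) = (if i = 0
    then Cubic p (3 * (p * u - q * w)) (3 * (p * (u\<^sup>2 - w\<^sup>2) - 2 * q * u * w))
        (p * (u^3 - 3 * u * w\<^sup>2) - q * (3 * u\<^sup>2 * w - w^3))
    else Cubic p (3 * p * u - q * w) (p * (3 * u\<^sup>2 + w\<^sup>2) - 2 * q * u * w)
        ((p * u - q * w) * (u\<^sup>2 + w\<^sup>2)))"
  by (simp add: model_def twist_def algebra_simps power2_eq_square power3_eq_cube)

text \<open>Shows that a form fixes the coordinates \<open>u\<close>, \<open>t\<close> and
  \<open>l\<close> of the group elements producing it, leaving only the rotation open.\<close>

lemma model_inject:
  assumes eq: "model i \<zeta> \<sigma> = model i \<zeta>' \<sigma>'" and pos: "Im \<sigma> > 0" "Im \<sigma>' > 0"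
    and nz: "Re \<zeta> \<noteq> 0"
  shows "\<zeta> = \<zeta>'" "\<sigma> = \<sigma>'"
proof -
  obtain p q u w where z: "\<zeta> = Complex p q" "\<sigma> = Complex u w" by (metis complex.exhaust)
  obtain p' q' u' w' where z': "\<zeta>' = Complex p' q'" "\<sigma>' = Complex u' w'" by (metis complex.exhaust)
  have w: "w > 0" "w' > 0" "p \<noteq> 0" using pos nz by (simp_all add: z z')
  have "p' = p \<and> u' = u \<and> w' = w \<and> q' = q"
  proof (cases "i = 0")
    case True
    text \<open>\<open>\<sigma>\<close> is the root of the Hessian \<open>(b\<^sup>2 - 3ac, bc - 9ad, c\<^sup>2 - 3bd)\<close>.\<close>
    define N N' where "N = (p\<^sup>2 + q\<^sup>2) * w\<^sup>2" and "N' = (p'\<^sup>2 + q'\<^sup>2) * w'\<^sup>2"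
    have e: "p' = p" "3 * (p * u - q * w) = 3 * (p' * u' - q' * w')"
      "3 * (p * (u\<^sup>2 - w\<^sup>2) - 2 * q * u * w) = 3 * (p' * (u'\<^sup>2 - w'\<^sup>2) - 2 * q' * u' * w')"
      "p * (u^3 - 3 * u * w\<^sup>2) - q * (3 * u\<^sup>2 * w - w^3)
        = p' * (u'^3 - 3 * u' * w'\<^sup>2) - q' * (3 * u'\<^sup>2 * w' - w'^3)"
      using eq True by (auto simp: z z' model_components)
    define H K L where "H = (\<lambda>a b c :: real. b\<^sup>2 - 3 * a * c)" and "K = (\<lambda>a b c d :: real. b * c - 9 * a * d)"
      and "L = (\<lambda>b c d :: real. c\<^sup>2 - 3 * b * d)"
    have H: "H p (3 * (p * u - q * w)) (3 * (p * (u\<^sup>2 - w\<^sup>2) - 2 * q * u * w)) = 9 * ((p\<^sup>2 + q\<^sup>2) * w\<^sup>2)"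
      and K: "K p (3 * (p * u - q * w)) (3 * (p * (u\<^sup>2 - w\<^sup>2) - 2 * q * u * w))
        (p * (u^3 - 3 * u * w\<^sup>2) - q * (3 * u\<^sup>2 * w - w^3)) = 18 * (((p\<^sup>2 + q\<^sup>2) * w\<^sup>2) * u)"
      and L: "L (3 * (p * u - q * w)) (3 * (p * (u\<^sup>2 - w\<^sup>2) - 2 * q * u * w))
        (p * (u^3 - 3 * u * w\<^sup>2) - q * (3 * u\<^sup>2 * w - w^3)) = 9 * (((p\<^sup>2 + q\<^sup>2) * w\<^sup>2) * (u\<^sup>2 + w\<^sup>2))"
      for p q u w
      unfolding H_def K_def L_def by algebra+
    have 1: "N = N'" "N * u = N' * u'" "N * (u\<^sup>2 + w\<^sup>2) = N' * (u'\<^sup>2 + w'\<^sup>2)"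
      using H[of p u q w] H[of p' u' q' w'] K[of p u q w] K[of p' u' q' w']
        L[of p u q w] L[of p' u' q' w'] unfolding e N_def N'_def by simp_all
    have "N \<noteq> 0" using w by (auto simp: N_def sum_power2_eq_zero_iff)
    hence u: "u = u'" "w\<^sup>2 = w'\<^sup>2" using 1 by auto
    hence ww: "w' = w" using w by (simp add: power2_eq_iff_nonneg)
    moreover have "q = q'" using e(1,2) w unfolding ww u by auto
    ultimately show ?thesis using e(1) u(1) by simp
  next
    case False
    text \<open>The real linear factor of the form is \<open>pX + sY\<close>.\<close>
    define s s' where "s = p * u - q * w" and "s' = p' * u' - q' * w'"
    have "3 * p * u - q * w = s + 2 * u * p" "3 * p' * u' - q' * w' = s' + 2 * u' * p'"
      "p * (3 * u\<^sup>2 + w\<^sup>2) - 2 * q * u * w = 2 * u * s + p * (u\<^sup>2 + w\<^sup>2)"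
      "p' * (3 * u'\<^sup>2 + w'\<^sup>2) - 2 * q' * u' * w' = 2 * u' * s' + p' * (u'\<^sup>2 + w'\<^sup>2)"
      unfolding s_def s'_def by algebra+
    hence e: "p' = p" "s + 2 * u * p = s' + 2 * u' * p'"
      "2 * u * s + p * (u\<^sup>2 + w\<^sup>2) = 2 * u' * s' + p' * (u'\<^sup>2 + w'\<^sup>2)"
      "s * (u\<^sup>2 + w\<^sup>2) = s' * (u'\<^sup>2 + w'\<^sup>2)"
      using eq False by (auto simp: z z' model_components s_def s'_def)
    \<comment> \<open>Both sides are the second form evaluated at \<open>(s, - p)\<close>, a zero of
      the linear factor of the first.\<close>
    have "p * ((s - s') * ((s - u' * p)\<^sup>2 + (w' * p)\<^sup>2)) = p * s^3 - (s' + 2 * u' * p) * s\<^sup>2 * p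
      + (2 * u' * s' + p * (u'\<^sup>2 + w'\<^sup>2)) * s * p\<^sup>2 - s' * (u'\<^sup>2 + w'\<^sup>2) * p^3"
      by algebra
    also have "\<dots> = p * s^3 - (s + 2 * u * p) * s\<^sup>2 * p
      + (2 * u * s + p * (u\<^sup>2 + w\<^sup>2)) * s * p\<^sup>2 - s * (u\<^sup>2 + w\<^sup>2) * p^3"
      by (simp only: e(2-4)[unfolded e(1)])
    also have "\<dots> = 0" by algebra
    finally have "(s - s') * ((s - u' * p)\<^sup>2 + (w' * p)\<^sup>2) = 0" using w by simp
    moreover have "(w' * p)\<^sup>2 > 0" using w by simp
    ultimately have s: "s = s'" by (smt (verit) mult_eq_0_iff zero_le_power2)
    hence u: "u' = u" using e(1,2) w(3) by simp
    hence "w\<^sup>2 = w'\<^sup>2" using e(1,3) w(3) s u by simp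
    hence ww: "w' = w" using w by (simp add: power2_eq_iff_nonneg)
    moreover have "q = q'" using s w(1) unfolding s_def s'_def e(1) u ww by auto
    ultimately show ?thesis using e(1) u by simp
  qed
  thus "\<zeta> = \<zeta>'" "\<sigma> = \<sigma>'" by (simp_all add: z z')
qed

lemma t0_pos: "t0 > 0"
  by (simp add: t0_def)

lemma gauss_domainE:
  assumes "g \<in> gauss_domain \<nu>"
  obtains u t e l where "g = mat_n u ** mat_a t ** rot e ** mat l" "u \<in> \<nu> t" "t \<ge> t0" "t > 0"
    "norm e = 1" "l > 0"
proof -
  obtain u t k l where *: "g = mat_n u ** mat_a t ** k ** mat l" "u \<in> \<nu> t" "t \<ge> t0"
    "rotation_matrix k" "l > 0"
    using assms by (auto simp: gauss_domain_def)
  obtain e where "norm e = 1" "k = rot e" by (rule rotation_matrix_rot[OF *(4)])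
  thus ?thesis using that * less_le_trans[OF t0_pos *(3)] by blast
qed

text \<open>For \<open>i = 0\<close> these are cube roots of \<open>c\<close>; otherwise
  \<open>e\<^sup>2 * cnj e = e\<close> on the unit circle and only \<open>c\<close> itself
  remains.\<close>

lemma twisted_cube_roots:
  assumes "norm c = 1"
  shows "finite {e. norm e = 1 \<and> e\<^sup>2 * twist i e = c}" "card {e. norm e = 1 \<and> e\<^sup>2 * twist i e = c} \<le> 3"
proof -
  have "\<exists>R. {e. norm e = 1 \<and> e\<^sup>2 * twist i e = c} \<subseteq> R \<and> finite R \<and> card R \<le> 3"
  proof (cases "i = 0")
    case True
    have "card {e. e ^ 3 = c} = 3" by (rule card_nth_roots) (use assms in auto)
    moreover from this have "finite {e. e ^ 3 = c}" by (simp add: card_ge_0_finite)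
    ultimately show ?thesis using True
      by (intro exI[of _ "{e. e ^ 3 = c}"]) (auto simp: twist_def power2_eq_square power3_eq_cube)
  next
    case False
    have "e\<^sup>2 * twist i e = e" if "norm e = 1" for e
      using that False by (simp add: twist_def power2_eq_square mult.assoc flip: complex_norm_square)
    thus ?thesis by (intro exI[of _ "{c}"]) auto
  qed
  then obtain R where R: "{e. norm e = 1 \<and> e\<^sup>2 * twist i e = c} \<subseteq> R" "finite R" "card R \<le> 3" by blast
  thus "finite {e. norm e = 1 \<and> e\<^sup>2 * twist i e = c}" "card {e. norm e = 1 \<and> e\<^sup>2 * twist i e = c} \<le> 3"
    using finite_subset[OF R(1,2)] le_trans[OF card_mono[OF R(2,1)] R(3)] by simp_all
qed

text \<open>By \<open>model_inject\<close> the value of \<open>\<sigma>\<close> gives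
  \<open>u\<close> and \<open>t\<close>, the norm of the leading parameter gives \<open>l\<close>,
  and its argument fixes \<open>e\<close> up to a twisted cube root.\<close>

lemma fiber_bound:
  fixes \<zeta> :: complex and f :: "real cubic" and i :: nat and \<nu> :: "real \<Rightarrow> real set"
  assumes \<zeta>: "\<zeta> \<noteq> 0" and f: "cX3 f \<noteq> 0"
  defines "F \<equiv> {g \<in> gauss_domain \<nu>. act g (model i \<zeta> \<i>) = f}"
  shows "finite F" "card F \<le> 3"
proof -
  have "finite F \<and> card F \<le> 3"
  proof (cases "F = {}")
    case False
    then obtain g0 where g0: "g0 \<in> F" by blast
    then obtain u0 t0 e0 l0 where p0: "g0 = mat_n u0 ** mat_a t0 ** rot e0 ** mat l0" "t0 > 0"
      "norm e0 = 1" "l0 > 0" unfolding F_def by (metis (lifting) gauss_domainE mem_Collect_eq)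
    define c where "c = e0\<^sup>2 * twist i e0"
    have c: "norm c = 1" by (simp add: c_def norm_mult norm_power p0)
    let ?E = "{e. norm e = 1 \<and> e\<^sup>2 * twist i e = c}"
    let ?h = "\<lambda>e. mat_n u0 ** mat_a t0 ** rot e ** mat l0"
    have f0: "f = model i (of_real (l0 / t0^3) * \<zeta> * c) (Complex u0 (t0\<^sup>2))"
      using g0 p0 by (auto simp: F_def act_model c_def)
    have sub: "F \<subseteq> ?h ` ?E"
    proof
      fix g assume g: "g \<in> F"
      then obtain u t e l where p: "g = mat_n u ** mat_a t ** rot e ** mat l" "t > 0"
        "norm e = 1" "l > 0" unfolding F_def by (metis (lifting) gauss_domainE mem_Collect_eq)
      have f1: "f = model i (of_real (l / t^3) * \<zeta> * (e\<^sup>2 * twist i e)) (Complex u (t\<^sup>2))"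
        using g p by (auto simp: F_def act_model)
      have "Re (of_real (l0 / t0^3) * \<zeta> * c) \<noteq> 0" using f unfolding f0 by (simp add: model_def)
      note inj = model_inject[OF trans[OF f0[symmetric] f1] _ _ this]
      have 1: "of_real (l0 / t0^3) * \<zeta> * c = of_real (l / t^3) * \<zeta> * (e\<^sup>2 * twist i e)"
        using inj(1) p p0 by simp
      have 2: "Complex u0 (t0\<^sup>2) = Complex u (t\<^sup>2)"
        using inj(2) p p0 by simp
      have t: "t = t0" "u = u0" using 2 p(2) p0(2) by (auto simp: power2_eq_iff_nonneg)
      have "norm (of_real (l0 / t0^3) * \<zeta> * c) = norm (of_real (l / t^3) * \<zeta> * (e\<^sup>2 * twist i e))"
        using 1 by simp
      hence "l = l0" using \<zeta> p p0 c by (simp add: norm_mult norm_power t norm_divide)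
      moreover from this have "e\<^sup>2 * twist i e = c" using 1 \<zeta> p0 unfolding t by simp
      ultimately show "g \<in> ?h ` ?E" using p t by blast
    qed
    have fin: "finite (?h ` ?E)" using twisted_cube_roots(1)[OF c] by simp
    have "card F \<le> card (?h ` ?E)" by (rule card_mono[OF fin sub])
    also have "\<dots> \<le> card ?E" by (rule card_image_le[OF twisted_cube_roots(1)[OF c]])
    also have "\<dots> \<le> 3" by (rule twisted_cube_roots(2)[OF c])
    finally show ?thesis using finite_subset[OF sub fin] by simp
  qed auto
  thus "finite F" "card F \<le> 3" by auto
qed

section \<open>Coefficient bounds and comparison of counts\<close>

text \<open>Each coefficient is the real part of \<open>\<zeta>\<close> times a sum of at most three
  monomials in \<open>\<sigma>\<close> and \<open>twist i \<sigma>\<close>, each of norm at most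
  \<open>(1 + B)^3\<close>.\<close>

lemma model_coeff_bound:
  fixes \<zeta> \<sigma> :: complex and i :: nat and B :: real
  assumes "\<bar>Re \<sigma>\<bar> \<le> 1/2" "\<bar>Im \<sigma>\<bar> \<le> B"
  defines "M \<equiv> 3 * norm \<zeta> * (1 + B)^3"
  shows "\<bar>cX2Y (model i \<zeta> \<sigma>)\<bar> \<le> M" "\<bar>cXY2 (model i \<zeta> \<sigma>)\<bar> \<le> M" "\<bar>cY3 (model i \<zeta> \<sigma>)\<bar> \<le> M"
proof -
  define S where "S = 1 + B"
  have S: "norm \<sigma> \<le> S" "S \<ge> 1" using assms cmod_le[of \<sigma>] by (auto simp: S_def)
  have S2: "S\<^sup>2 \<le> S^3" "S \<le> S^3" "(norm \<sigma>)\<^sup>2 \<le> S\<^sup>2" "(norm \<sigma>)^3 \<le> S^3"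
    using S power_increasing[of 2 3 S] power_increasing[of 1 3 S] by (auto intro: power_mono)
  have b: "\<bar>Re (\<zeta> * x)\<bar> \<le> M" if "norm x \<le> 3 * S^3" for x
  proof -
    have "\<bar>Re (\<zeta> * x)\<bar> \<le> norm \<zeta> * norm x" using abs_Re_le_cmod[of "\<zeta> * x"] by (simp add: norm_mult)
    also have "\<dots> \<le> norm \<zeta> * (3 * S^3)" by (intro mult_left_mono that) auto
    finally show ?thesis by (simp add: M_def S_def)
  qed
  have "norm (2 * \<sigma> + twist i \<sigma>) \<le> 3 * S^3"
    using norm_triangle_ineq[of "2 * \<sigma>" "twist i \<sigma>"] S S2 by (simp add: norm_mult)
  thus "\<bar>cX2Y (model i \<zeta> \<sigma>)\<bar> \<le> M" by (simp only: model_def cubic.sel b)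
  have "norm (\<sigma>\<^sup>2 + 2 * \<sigma> * twist i \<sigma>) \<le> 3 * S^3"
    using norm_triangle_ineq[of "\<sigma>\<^sup>2" "2 * \<sigma> * twist i \<sigma>"] S S2 
    by (simp add: norm_mult norm_power power2_eq_square)
  thus "\<bar>cXY2 (model i \<zeta> \<sigma>)\<bar> \<le> M" by (simp only: model_def cubic.sel b)
  have "norm (\<sigma>\<^sup>2 * twist i \<sigma>) = norm \<sigma> ^ 3"
    by (simp add: norm_mult norm_power power2_eq_square power3_eq_cube)
  hence "norm (\<sigma>\<^sup>2 * twist i \<sigma>) \<le> 3 * S^3"
    using S2(4) zero_le_power[OF norm_ge_zero[of \<sigma>], of 3] by linarith
  thus "\<bar>cY3 (model i \<zeta> \<sigma>)\<bar> \<le> M" by (simp only: model_def cubic.sel b mult.assoc)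
qed

text \<open>The condition at \<open>P\<close> fixes the leading coefficient, so only three
  coefficients vary: a box with \<open>R\<close> of order \<open>X powr (1/4)\<close> has
  \<open>O(X powr (3/4))\<close> forms.\<close>

definition integral_box :: "real \<Rightarrow> real \<Rightarrow> real cubic set" where
  "integral_box a R = {Cubic a b c d | b c d. {b, c, d} \<subseteq> \<int> \<inter> {-R..R}}"

lemma integral_box:
  assumes "R \<ge> 0"
  shows "finite (integral_box a R)" "real (card (integral_box a R)) \<le> (2 * R + 1)^3"
proof -
  define Z where "Z = real_of_int ` {- \<lfloor>R\<rfloor>..\<lfloor>R\<rfloor>}"
  have "\<int> \<inter> {-R..R} \<subseteq> Z"
  proof
    fix x assume x: "x \<in> \<int> \<inter> {-R..R}"
    then obtain z where z: "x = real_of_int z" by (auto elim: Ints_cases)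
    have "z \<in> {- \<lfloor>R\<rfloor>..\<lfloor>R\<rfloor>}" using x unfolding z by (simp add: le_floor_iff) linarith
    thus "x \<in> Z" by (simp add: Z_def z)
  qed
  hence "integral_box a R \<subseteq> (\<lambda>(b, c, d). Cubic a b c d) ` (Z \<times> Z \<times> Z)"
    by (force simp: integral_box_def)
  moreover have fin: "finite (Z \<times> Z \<times> Z)" by (simp add: Z_def)
  ultimately show "finite (integral_box a R)" using finite_subset by blast
  have "card (integral_box a R) \<le> card (Z \<times> Z \<times> Z)"
    by (rule surj_card_le[OF fin]) fact
  also have "\<dots> = card Z ^ 3" by (simp add: power3_eq_cube card_cartesian_product)
  finally have "real (card (integral_box a R)) \<le> real (card Z) ^ 3"
    by (simp flip: of_nat_power)
  also have "card Z = nat (2 * \<lfloor>R\<rfloor> + 1)"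
    by (simp add: Z_def card_image inj_on_def)
  also have "real \<dots> ^ 3 \<le> (2 * R + 1)^3"
    using assms by (intro power_mono) auto
  finally show "real (card (integral_box a R)) \<le> (2 * R + 1)^3" .
qed

text \<open>Both counts are sums of fibre sizes over one finite set of forms. Outside
  \<open>B\<close> the fibres over \<open>S\<close> and \<open>S'\<close> agree, on \<open>B\<close>
  they differ by at most three, and every form in the orbit contributes at least one.\<close>

lemma form_count_difference:
  fixes S S' v i P cm cp X
  defines "A \<equiv> {f \<in> V_int_irr i. form_eval f P = 1 \<and> cm * X \<le> \<bar>disc f\<bar> \<and> \<bar>disc f\<bar> < cp * X}"
  assumes sub: "S' \<subseteq> S"
    and fib: "\<And>f. f \<in> A \<Longrightarrow> finite {g \<in> S. act g v = f}" "\<And>f. f \<in> A \<Longrightarrow> card {g \<in> S. act g v = f} \<le> 3"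
    and fin: "finite ((\<lambda>g. act g v) ` S \<inter> A)"
    and low: "(\<lambda>g. act g v) ` (S - S') \<inter> A \<subseteq> B" "finite B"
  shows "form_count S' i v P cm cp X \<le> form_count S i v P cm cp X"
    "form_count S i v P cm cp X \<le> form_count S' i v P cm cp X + 3 * card B"
    "card ((\<lambda>g. act g v) ` S \<inter> A) \<le> form_count S i v P cm cp X"
proof -
  define \<Phi> where "\<Phi> = (\<lambda>g. act g v) ` S \<inter> A"
  have eq: "form_count Q i v P cm cp X = (\<Sum>f\<in>\<Phi>. card {g \<in> Q. act g v = f})" if "Q \<subseteq> S" for Q
  proof -
    have "form_count Q i v P cm cp X = (\<Sum>f\<in>(\<lambda>g. act g v) ` Q \<inter> A. card {g \<in> Q. act g v = f})"
      unfolding form_count_def orbit_mult_def A_def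
      by (rule arg_cong2[where f = sum, OF refl]) blast
    also have "\<dots> = (\<Sum>f\<in>\<Phi>. card {g \<in> Q. act g v = f})"
    proof (rule sum.mono_neutral_left)
      show "\<forall>f\<in>\<Phi> - (\<lambda>g. act g v) ` Q \<inter> A. card {g \<in> Q. act g v = f} = 0"
      proof
        fix f assume "f \<in> \<Phi> - (\<lambda>g. act g v) ` Q \<inter> A"
        hence "f \<notin> (\<lambda>g. act g v) ` Q" unfolding \<Phi>_def by blast
        hence "{g \<in> Q. act g v = f} = {}" by blast
        thus "card {g \<in> Q. act g v = f} = 0" by (simp only: card.empty)
      qed
      show "finite \<Phi>" unfolding \<Phi>_def by (rule fin)
      show "(\<lambda>g. act g v) ` Q \<inter> A \<subseteq> \<Phi>" unfolding \<Phi>_def using that by blast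
    qed
    finally show ?thesis .
  qed
  have A: "f \<in> A" if "f \<in> \<Phi>" for f using that by (simp add: \<Phi>_def)
  show "form_count S' i v P cm cp X \<le> form_count S i v P cm cp X"
    unfolding eq[OF sub] eq[OF order_refl] using sub
    by (intro sum_mono card_mono fib(1) A) blast+
  have "card \<Phi> = (\<Sum>f\<in>\<Phi>. 1)" by simp
  also have "\<dots> \<le> form_count S i v P cm cp X"
    unfolding eq[OF order_refl]
  proof (rule sum_mono)
    fix f assume f: "f \<in> \<Phi>"
    hence "{g \<in> S. act g v = f} \<noteq> {}" unfolding \<Phi>_def by blast
    with fib(1)[OF A[OF f]] have "0 < card {g \<in> S. act g v = f}"
      unfolding card_gt_0_iff by (intro conjI)
    thus "1 \<le> card {g \<in> S. act g v = f}" by linarith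
  qed
  finally show "card ((\<lambda>g. act g v) ` S \<inter> A) \<le> form_count S i v P cm cp X" by (simp add: \<Phi>_def)
  have "form_count S i v P cm cp X
      \<le> (\<Sum>f\<in>\<Phi>. card {g \<in> S'. act g v = f} + (if f \<in> B then 3 else 0))"
    unfolding eq[OF order_refl]
  proof (rule sum_mono)
    fix f assume f: "f \<in> \<Phi>"
    show "card {g \<in> S. act g v = f} \<le> card {g \<in> S'. act g v = f} + (if f \<in> B then 3 else 0)"
    proof (cases "f \<in> B")
      case True
      thus ?thesis using fib(2)[OF A[OF f]] by simp
    next
      case False
      hence "{g \<in> S. act g v = f} = {g \<in> S'. act g v = f}" using low(1) A[OF f] sub by blast
      thus ?thesis using False by (simp only: if_False add_0_right order_refl)
    qed
  qed
  also have "\<dots> = form_count S' i v P cm cp X + 3 * card (\<Phi> \<inter> B)"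
    using fin[folded \<Phi>_def] by (simp add: sum.distrib eq[OF sub] sum.If_cases)
  also have "card (\<Phi> \<inter> B) \<le> card B" by (intro card_mono low(2)) auto
  finally show "form_count S i v P cm cp X \<le> form_count S' i v P cm cp X + 3 * card B" by simp
qed

text \<open>With \<open>Im \<sigma>\<close> bounded below, the discriminant bounds
  \<open>norm \<zeta>\<close> by a multiple of \<open>D powr (1/4)\<close>; with
  \<open>Im \<sigma>\<close> bounded above, all coefficients are of that order.\<close>

lemma model_coeff_disc_bound:
  assumes \<sigma>: "\<bar>Re \<sigma>\<bar> \<le> 1/2" "t0\<^sup>2 \<le> Im \<sigma>" "Im \<sigma> \<le> B"
    and D: "\<bar>disc (model i \<zeta> \<sigma>)\<bar> < D"
    and a: "cX3 (model i \<zeta> \<sigma>) = a" and int: "model i \<zeta> \<sigma> \<in> V_int_irr j"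
  shows "model i \<zeta> \<sigma> \<in> integral_box a (3 * (1 + B)^3 * (D / (4 * t0^12)) powr (1/4))"
proof -
  let ?f = "model i \<zeta> \<sigma>"
  define R where "R = 3 * (1 + B)^3 * (D / (4 * t0^12)) powr (1/4)"
  have "0 < t0\<^sup>2" using t0_pos by simp
  hence pos: "Im \<sigma> > 0" using \<sigma> by linarith
  have "(t0\<^sup>2)^6 \<le> Im \<sigma> ^ 6" by (intro power_mono \<sigma>) simp
  hence "4 * norm \<zeta>^4 * t0^12 \<le> 4 * norm \<zeta>^4 * Im \<sigma> ^ 6"
    by (intro mult_left_mono) simp_all
  \<comment> \<open>The factor \<open>4\<close> is the smaller of the constants \<open>108\<close>
    and \<open>4\<close>, so it serves both signs.\<close>
  also have "\<dots> \<le> \<bar>disc ?f\<bar>" using pos by (simp add: disc_model abs_mult)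
  finally have "norm \<zeta>^4 \<le> D / (4 * t0^12)" using D t0_pos by (simp add: field_simps)
  hence "(norm \<zeta>^4) powr (1/4) \<le> (D / (4 * t0^12)) powr (1/4)"
    by (intro powr_mono2) simp_all
  moreover have "(norm \<zeta>^4) powr (1/4) = norm \<zeta>"
    by (cases "\<zeta> = 0") (simp_all add: powr_powr flip: powr_numeral)
  ultimately have "norm \<zeta> \<le> (D / (4 * t0^12)) powr (1/4)" by simp
  hence "3 * (1 + B)^3 * norm \<zeta> \<le> R"
    unfolding R_def using pos \<sigma> by (intro mult_left_mono) simp_all
  moreover have "\<bar>Im \<sigma>\<bar> \<le> B" using pos \<sigma> by simp
  note b = model_coeff_bound[OF \<sigma>(1) this, of i \<zeta>]
  ultimately have "\<bar>cX2Y ?f\<bar> \<le> R" "\<bar>cXY2 ?f\<bar> \<le> R" "\<bar>cY3 ?f\<bar> \<le> R"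
    using b by (simp_all add: mult_ac)
  moreover have "{cX2Y ?f, cXY2 ?f, cY3 ?f} \<subseteq> \<int>" using int by (simp add: V_int_irr_def V_int_def)
  moreover have "?f = Cubic a (cX2Y ?f) (cXY2 ?f) (cY3 ?f)" using a by (cases ?f) simp
  ultimately show ?thesis unfolding integral_box_def R_def[symmetric] mem_Collect_eq
    by (intro exI[of _ "cX2Y ?f"] exI[of _ "cXY2 ?f"] exI[of _ "cY3 ?f"]) (simp add: abs_le_iff)
qed

lemma gauss_slice_bound:
  assumes "gauss_slices \<nu>" "t \<ge> t0" "u \<in> \<nu> t"
  shows "\<bar>u\<bar> \<le> 1/2"
  using assms by (fastforce simp: gauss_slices_def abs_le_iff)

lemma gauss_domain_form_bounded_height:
  assumes \<nu>: "gauss_slices \<nu>" and g: "g \<in> gauss_domain \<nu> - gauss_domain_above \<nu> T" and v: "v = model i \<zeta> \<i>"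
    and D: "\<bar>disc (act g v)\<bar> < D" and a: "cX3 (act g v) = a" and int: "act g v \<in> V_int_irr j"
  shows "act g v \<in> integral_box a (3 * (1 + T\<^sup>2)^3 * (D / (4 * t0^12)) powr (1/4))"
proof -
  obtain u t e l where p: "g = mat_n u ** mat_a t ** rot e ** mat l" "u \<in> \<nu> t" "t \<ge> t0" "t > 0"
    "norm e = 1" "l > 0"
    using g by (auto elim: gauss_domainE)
  have "t \<le> T" using g p rotation_matrix_rotI[OF p(5)] unfolding gauss_domain_above_def
    by (auto simp: not_less[symmetric])
  have act: "act g v = model i (of_real (l / t^3) * \<zeta> * (e\<^sup>2 * twist i e)) (Complex u (t\<^sup>2))"
    unfolding p(1) v by (rule act_model) (use p in auto)
  show ?thesis unfolding act
  proof (rule model_coeff_disc_bound)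
    show "\<bar>Re (Complex u (t\<^sup>2))\<bar> \<le> 1/2" using gauss_slice_bound[OF \<nu> p(3,2)] by simp
    show "t0\<^sup>2 \<le> Im (Complex u (t\<^sup>2))" "Im (Complex u (t\<^sup>2)) \<le> T\<^sup>2"
      using p \<open>t \<le> T\<close> t0_pos by (simp_all add: power_mono)
  qed (use D a int in \<open>simp_all only: act\<close>)
qed

text \<open>A leading coefficient \<open>\<plusminus>1\<close> forces
  \<open>norm \<zeta> \<ge> 1\<close>, so the discriminant alone bounds the height
  \<open>Im \<sigma>\<close>. Finiteness matters because \<open>card\<close> and sums over infinite
  sets default to \<open>0\<close>.\<close>

lemma gauss_domain_forms_finite:
  assumes \<nu>: "gauss_slices \<nu>" and v: "v = model i \<zeta> \<i>" and a: "\<bar>a\<bar> = 1" and D: "D \<ge> 0"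
  shows "finite ((\<lambda>g. act g v) ` gauss_domain \<nu> \<inter> {f \<in> V_int_irr j. cX3 f = a \<and> \<bar>disc f\<bar> < D})"
proof (rule finite_subset)
  show "finite (integral_box a (3 * (1 + (1 + D))^3 * (D / (4 * t0^12)) powr (1/4)))"
    by (rule integral_box(1)) (use D in simp)
  show "(\<lambda>g. act g v) ` gauss_domain \<nu> \<inter> {f \<in> V_int_irr j. cX3 f = a \<and> \<bar>disc f\<bar> < D}
      \<subseteq> integral_box a (3 * (1 + (1 + D))^3 * (D / (4 * t0^12)) powr (1/4))"
  proof
    fix f assume f: "f \<in> (\<lambda>g. act g v) ` gauss_domain \<nu> \<inter> {f \<in> V_int_irr j. cX3 f = a \<and> \<bar>disc f\<bar> < D}"
    then obtain g where g: "g \<in> gauss_domain \<nu>" "f = act g v" by blast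
    obtain u t e l where p: "g = mat_n u ** mat_a t ** rot e ** mat l" "u \<in> \<nu> t" "t \<ge> t0" "t > 0"
      "norm e = 1" "l > 0"
      using g(1) by (auto elim: gauss_domainE)
    define z \<sigma> where "z = of_real (l / t^3) * \<zeta> * (e\<^sup>2 * twist i e)" and "\<sigma> = Complex u (t\<^sup>2)"
    have act: "f = model i z \<sigma>"
      unfolding g(2) p(1) v z_def \<sigma>_def by (rule act_model) (use p in auto)
    have "\<bar>Re z\<bar> = 1" using f a by (simp add: act model_def)
    hence "norm z \<ge> 1" using abs_Re_le_cmod[of z] by simp
    hence "1 \<le> norm z ^ 4" by simp
    moreover have pos: "Im \<sigma> > 0" using p by (simp add: \<sigma>_def)
    ultimately have "1 * Im \<sigma> ^ 6 \<le> norm z ^ 4 * Im \<sigma> ^ 6" by (intro mult_right_mono) simp_all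
    also have "\<dots> \<le> \<bar>disc (model i z \<sigma>)\<bar>" using pos by (simp add: disc_model abs_mult)
    also have "\<dots> < D" using f by (simp add: act)
    finally have "Im \<sigma> ^ 6 < D" by simp
    \<comment> \<open>A crude bound that avoids extracting a sixth root.\<close>
    moreover have "Im \<sigma> \<le> 1 + Im \<sigma> ^ 6"
    proof (cases "Im \<sigma> \<le> 1")
      case False
      thus ?thesis using power_increasing[of 1 6 "Im \<sigma>"] by simp
    qed (use pos in \<open>simp add: add_increasing2\<close>)
    ultimately have le: "Im \<sigma> \<le> 1 + D" by simp
    have "\<bar>Re \<sigma>\<bar> \<le> 1/2" "t0\<^sup>2 \<le> Im \<sigma>"
      using gauss_slice_bound[OF \<nu> p(3,2)] p t0_pos by (simp_all add: \<sigma>_def power_mono)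
    from model_coeff_disc_bound[OF this le, of i z D a j]
    show "f \<in> integral_box a (3 * (1 + (1 + D))^3 * (D / (4 * t0^12)) powr (1/4))"
      using f by (simp add: act)
  qed
qed

text \<open>Inverts \<open>act_model\<close>: \<open>t\<close> is the square root of
  \<open>Im \<sigma>\<close>, \<open>e\<close> corrects the argument and \<open>l\<close> the
  modulus. Since \<open>t \<ge> 1\<close>, the slice at \<open>t\<close> is the whole interval,
  whatever the boundary convention.\<close>

lemma model_in_gauss_orbit:
  assumes \<nu>: "gauss_slices \<nu>" and \<zeta>0: "\<zeta>0 \<noteq> 0" and \<zeta>: "\<zeta> \<noteq> 0"
    and \<sigma>: "\<bar>Re \<sigma>\<bar> \<le> 1/2" "Im \<sigma> \<ge> 1"
  shows "model i \<zeta> \<sigma> \<in> (\<lambda>g. act g (model i \<zeta>0 \<i>)) ` gauss_domain \<nu>"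
proof -
  define t where "t = sqrt (Im \<sigma>)"
  have t: "t \<ge> 1" "t\<^sup>2 = Im \<sigma>" using \<sigma> by (simp_all add: t_def)
  have "root 4 3 \<le> sqrt 2"
  proof -
    have "root 4 3 \<le> root 4 4" by simp
    also have "root 4 4 = sqrt (sqrt 4)"
      using real_root_mult_exp[of 2 2 4] by (simp add: sqrt_def)
    finally show ?thesis by simp
  qed
  hence "t0 \<le> 1" by (simp add: t0_def)
  have u: "Re \<sigma> \<in> \<nu> t" using \<nu> t \<sigma> by (auto simp: gauss_slices_def abs_le_iff)
  define c where "c = sgn \<zeta> / sgn \<zeta>0"
  have c: "norm c = 1" using \<zeta> \<zeta>0 by (simp add: c_def norm_divide norm_sgn)
  have "\<exists>e. norm e = 1 \<and> e\<^sup>2 * twist i e = c"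
  proof (cases "i = 0")
    case True
    have "cis (Arg c / 3) ^ 3 = cis (Arg c)" unfolding Complex.DeMoivre by simp
    also have "\<dots> = c" using c by (metis cis_Arg norm_zero sgn_eq zero_neq_one div_by_1 of_real_1)
    finally show ?thesis using True
      by (intro exI[of _ "cis (Arg c / 3)"]) (simp add: twist_def power2_eq_square power3_eq_cube)
  next
    case False
    thus ?thesis using c
      by (intro exI[of _ c])
        (simp add: twist_def power2_eq_square mult.assoc flip: complex_norm_square)
  qed
  then obtain e where e: "norm e = 1" "e\<^sup>2 * twist i e = c" by blast
  define l where "l = t^3 * norm \<zeta> / norm \<zeta>0"
  have l: "l > 0" using t \<zeta> \<zeta>0 by (simp add: l_def)
  have "of_real (l / t^3) * \<zeta>0 * c = \<zeta>"
  proof -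
    have "of_real (l / t^3) = (of_real (norm \<zeta>) / of_real (norm \<zeta>0) :: complex)"
      using t by (simp add: l_def)
    moreover have "\<zeta> = of_real (norm \<zeta>) * sgn \<zeta>" "\<zeta>0 = of_real (norm \<zeta>0) * sgn \<zeta>0"
      using \<zeta> \<zeta>0 by (simp_all add: sgn_eq)
    moreover have "sgn \<zeta>0 \<noteq> 0" "of_real (norm \<zeta>0) \<noteq> (0 :: complex)" using \<zeta>0 by (simp_all add: sgn_zero_iff)
    ultimately show ?thesis unfolding c_def by (metis (no_types, lifting) divide_divide_eq_left
          mult.commute nonzero_mult_div_cancel_left times_divide_eq_right)
  qed
  hence "act (mat_n (Re \<sigma>) ** mat_a t ** rot e ** mat l) (model i \<zeta>0 \<i>) = model i \<zeta> \<sigma>"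
    using act_model[of t l e "Re \<sigma>" i \<zeta>0] t l e by simp
  moreover have "mat_n (Re \<sigma>) ** mat_a t ** rot e ** mat l \<in> gauss_domain \<nu>"
    unfolding gauss_domain_def mem_Collect_eq using u t \<open>t0 \<le> 1\<close> rotation_matrix_rotI[OF e(1)] l
    by (intro exI[of _ "Re \<sigma>"] exI[of _ t] exI[of _ "rot e"] exI[of _ l]) simp
  ultimately show ?thesis by (metis image_eqI)
qed

section \<open>A large family of forms in the orbit\<close>

text \<open>\<open>A\<close>, \<open>B\<close>, \<open>C\<close> are the Hessian coefficients, with
  \<open>4 A C - B\<^sup>2\<close> three times the discriminant, and
  \<open>\<sigma> = u + \<i> w\<close> satisfies \<open>u = B / (2 A)\<close> and
  \<open>u\<^sup>2 + w\<^sup>2 = C / A\<close>. The hypotheses on \<open>B\<close> and the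
  discriminant say exactly that \<open>\<bar>u\<bar> \<le> 1/2\<close> and
  \<open>w \<ge> 1\<close>.\<close>

lemma monic_cubic_model_pos:
  fixes b c d :: real
  defines "A \<equiv> b\<^sup>2 - 3 * c" and "B \<equiv> b * c - 9 * d"
  assumes A: "A > 0" and B: "\<bar>B\<bar> \<le> A" and D: "4 * A\<^sup>2 \<le> 3 * disc (Cubic 1 b c d)"
  obtains \<eta> \<sigma> where "Cubic 1 b c d = model 0 (Complex 1 \<eta>) \<sigma>" "\<bar>Re \<sigma>\<bar> \<le> 1/2" "Im \<sigma> \<ge> 1"
proof -
  define C where "C = c\<^sup>2 - 3 * b * d"
  define u where "u = B / (2 * A)"
  define w where "w = sqrt (3 * disc (Cubic 1 b c d)) / (2 * A)"
  have "2 * A \<le> sqrt (3 * disc (Cubic 1 b c d))"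
    using D by (intro real_le_rsqrt) (simp add: power_mult_distrib)
  hence w1: "w \<ge> 1" using A by (simp add: w_def)
  have "disc (Cubic 1 b c d) \<ge> 0" using D by (smt (verit) zero_le_power2)
  hence w2: "w\<^sup>2 = 3 * disc (Cubic 1 b c d) / (2 * A)\<^sup>2"
    by (simp add: w_def power_divide)
  have Bu: "B = 2 * A * u" using A by (simp add: u_def)
  have "(2 * A)\<^sup>2 * w\<^sup>2 = 3 * disc (Cubic 1 b c d)" using A by (simp add: w2)
  also have "\<dots> = 4 * A * C - B\<^sup>2"
    unfolding disc_def cubic.case power_one mult_1_right A_def B_def C_def by algebra
  finally have "4 * A * (A * (u\<^sup>2 + w\<^sup>2)) = 4 * A * C" unfolding Bu by algebra
  hence CS: "C = A * (u\<^sup>2 + w\<^sup>2)" using A by simp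
  \<comment> \<open>Forced by the \<open>X\<^sup>2 Y\<close> coefficient
    \<open>3 (u - \<eta> w) = b\<close>.\<close>
  define \<eta> where "\<eta> = (u - b / 3) / w"
  define \<beta> where "\<beta> = b / 3"
  have b: "b = 3 * \<beta>" by (simp add: \<beta>_def)
  have \<eta>: "\<eta> * w = u - \<beta>" using w1 by (simp add: \<eta>_def \<beta>_def)
  have cc: "c = 3 * ((u\<^sup>2 - w\<^sup>2) - 2 * u * (\<eta> * w))"
  proof -
    have "A * (3 * ((u\<^sup>2 - w\<^sup>2) - 2 * u * (\<eta> * w))) = - 3 * C + 3 * \<beta> * B"
      unfolding \<eta> Bu CS by algebra
    also have "\<dots> = A * c" unfolding A_def B_def C_def b by algebra
    finally show ?thesis using A by simp
  qed
  have dd: "d = u^3 - 3 * u * w\<^sup>2 - (\<eta> * w) * (3 * u\<^sup>2 - w\<^sup>2)"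
  proof -
    have "3 * A\<^sup>2 * (u^3 - 3 * u * w\<^sup>2 - (\<eta> * w) * (3 * u\<^sup>2 - w\<^sup>2)) = - 3 * B * C + 3 * \<beta> * (B\<^sup>2 - A * C)"
      unfolding \<eta> Bu CS by algebra
    also have "\<dots> = 3 * A\<^sup>2 * d" unfolding A_def B_def C_def b by algebra
    finally show ?thesis using A by simp
  qed
  have "Cubic 1 b c d = model 0 (Complex 1 \<eta>) (Complex u w)"
    unfolding model_components using \<eta> b cc dd by (simp add: algebra_simps power2_eq_square power3_eq_cube)
  moreover have "\<bar>u\<bar> \<le> 1/2" using A B by (simp add: u_def abs_divide)
  ultimately show ?thesis using that[of \<eta> "Complex u w"] w1 by simp
qed

text \<open>The cubic is \<open>(X + b) (X\<^sup>2 + c) + m\<close>, so a real root \<open>r\<close>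
  lies within \<open>1\<close> of \<open>- b\<close>. The other factor
  \<open>X\<^sup>2 + 2 u X + u\<^sup>2 + w\<^sup>2\<close> has \<open>2 u = b + r\<close>, which is
  small, while \<open>w\<^sup>2\<close> is close to \<open>c\<close>.\<close>

lemma monic_cubic_model_neg:
  fixes b c m :: real
  assumes b: "b \<ge> 0" and c: "c \<ge> b + 3" and m: "0 \<le> m" "m \<le> c"
  obtains \<eta> \<sigma> where "Cubic 1 b c (b * c + m) = model 1 (Complex 1 \<eta>) \<sigma>" "\<bar>Re \<sigma>\<bar> \<le> 1/2" "Im \<sigma> \<ge> 1"
proof -
  define p where "p = [: b * c + m, c, b, 1 :]"
  have p: "poly p x = x^3 + b * x\<^sup>2 + c * x + b * c + m" for x
    by (simp add: p_def algebra_simps power2_eq_square power3_eq_cube)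
  have "\<exists>r>- b - 1. r < - b + 1 \<and> poly p r = 0"
  proof (rule poly_IVT_pos)
    have "poly p (- b + 1) = (b - 1)\<^sup>2 + c + m" unfolding p by algebra
    also have "\<dots> > 0" using b c m by (smt (verit) zero_le_power2)
    finally show "0 < poly p (- b + 1)" .
    have "poly p (- b - 1) = - (b + 1)\<^sup>2 - c + m" unfolding p by algebra
    also have "\<dots> < 0" using b c m zero_less_power2[of "b + 1"] by linarith
    finally show "poly p (- b - 1) < 0" .
  qed simp
  then obtain r where r: "- b - 1 < r" "r < - b + 1" "r^3 + b * r\<^sup>2 + c * r + b * c + m = 0"
    unfolding p by blast
  define u where "u = (b + r) / 2"
  define E where "E = c + 2 * u * r - u\<^sup>2"
  define w where "w = sqrt E"
  have u: "\<bar>u\<bar> \<le> 1/2" using r by (simp add: u_def abs_le_iff)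
  have "\<bar>2 * u * r\<bar> \<le> 1 * (b + 1)"
    unfolding abs_mult using u r b by (intro mult_mono) auto
  moreover have "u\<^sup>2 \<le> (1/2)\<^sup>2" using power_mono[OF u, of 2] by simp
  \<comment> \<open>\<open>E\<close> is at least \<open>(b + 3) - (b + 1) - 1/4\<close>.\<close>
  ultimately have E: "E \<ge> 1" using c by (simp add: E_def power2_eq_square abs_le_iff)
  hence w: "w \<ge> 1" "w\<^sup>2 = E" by (simp_all add: w_def)
  \<comment> \<open>Chosen so that the linear factor \<open>X + (u - \<eta> w) Y\<close> of the
    model is \<open>X - r Y\<close>.\<close>
  define \<eta> where "\<eta> = (u + r) / w"
  have \<eta>: "\<eta> * w = u + r" using w by (simp add: \<eta>_def)
  have b_eq: "b = 2 * u - r" unfolding u_def by (simp add: field_simps)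
  hence "b = 3 * u - (\<eta> * w)" unfolding \<eta> by linarith
  moreover have "c = (3 * u\<^sup>2 + w\<^sup>2) - 2 * u * (\<eta> * w)"
    unfolding \<eta> w E_def by algebra
  moreover have "b * c + m = (u - \<eta> * w) * (u\<^sup>2 + w\<^sup>2)"
    using r(3) b_eq unfolding \<eta> w E_def by algebra
  ultimately have "Cubic 1 b c (b * c + m) = model 1 (Complex 1 \<eta>) (Complex u w)"
    unfolding model_components by (simp add: algebra_simps)
  thus ?thesis using that[of \<eta> "Complex u w"] w u by simp
qed

section \<open>Irreducibility by reduction modulo 2\<close>

text \<open>For a root \<open>p / q\<close> in lowest terms, the homogenised cubic is congruent to
  \<open>p^3 + p q\<^sup>2 + q^3\<close> modulo 2, which is even only if \<open>p\<close> and
  \<open>q\<close> both are.\<close>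

lemma cubic_no_rat_root:
  fixes a b c d :: int and x :: rat
  assumes "odd a" "even b" "odd c" "odd d"
  shows "of_int a * x^3 + of_int b * x\<^sup>2 + of_int c * x + of_int d \<noteq> 0"
proof
  assume *: "of_int a * x^3 + of_int b * x\<^sup>2 + of_int c * x + of_int d = 0"
  obtain p q where pq: "quotient_of x = (p, q)" by fastforce
  have q: "q > 0" "coprime p q" "x = of_int p / of_int q"
    using quotient_of_denom_pos[OF pq] quotient_of_coprime[OF pq] quotient_of_div[OF pq] by auto
  have "of_int (a * p^3 + b * p\<^sup>2 * q + c * p * q\<^sup>2 + d * q^3) = (0 :: rat)"
    using * q by (simp add: field_simps power2_eq_square power3_eq_cube)
  hence "a * p^3 + b * p\<^sup>2 * q + c * p * q\<^sup>2 + d * q^3 = 0" by linarith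
  hence "even (a * p^3 + b * p\<^sup>2 * q + c * p * q\<^sup>2 + d * q^3)" by simp
  hence "even p \<and> even q" using assms by auto
  thus False using q(2) by (meson coprime_common_divisor odd_one)
qed

text \<open>The leading coefficients in \<open>X\<close> of two factors multiply to the unit
  \<open>a\<close>. A factor of degree one therefore has a root in the polynomials in
  \<open>Y\<close>, and \<open>Y = 1\<close> turns it into a rational root; a factor of degree zero
  is a unit.\<close>

lemma irreducible_form_poly:
  fixes a b c d :: rat
  assumes a: "a \<noteq> 0" and no_root: "\<And>x. a * x^3 + b * x\<^sup>2 + c * x + d \<noteq> 0"
  shows "irreducible (form_poly (Cubic a b c d))"
proof -
  let ?F = "form_poly (Cubic a b c d)"
  have deg: "degree ?F = 3" and lc: "lead_coeff ?F = [:a:]" using a by (simp_all add: form_poly_def)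
  have F0: "?F \<noteq> 0" using deg by auto
  have lin: False if G_dvd: "G dvd ?F" and G_deg: "degree G = 1" and G_lc: "is_unit (lead_coeff G)" for G :: "rat poly poly"
  proof -
    obtain m l where G: "G = [:m, l:]" using G_deg degree1_coeffs[of G] by blast
    hence l: "is_unit l" using G_deg G_lc by auto
    then obtain k where k: "l * k = 1" by (auto elim: dvdE)
    have "poly G (- (m * k)) = 0" using k by (simp add: G algebra_simps)
    hence "poly ?F (- (m * k)) = 0" using G_dvd by (auto elim!: dvdE)
    hence "poly (poly ?F (- (m * k))) 1 = 0" by simp
    thus False using no_root[of "poly (- (m * k)) 1"]
      by (simp add: form_poly_def algebra_simps power2_eq_square power3_eq_cube)
  qed
  show ?thesis
  proof (rule irreducibleI)
    show "?F \<noteq> 0" by (rule F0)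
    show "\<not> is_unit ?F"
    proof
      assume "is_unit ?F"
      hence "degree ?F = 0" by (auto simp: is_unit_poly_iff)
      thus False using deg by simp
    qed
    fix G H assume GH: "?F = G * H"
    hence nz: "G \<noteq> 0" "H \<noteq> 0" using F0 by auto
    have sum: "degree G + degree H = 3" using deg nz by (simp add: GH degree_mult_eq)
    have "lead_coeff G * lead_coeff H = [:a:]" using lc by (simp add: GH lead_coeff_mult)
    moreover have "is_unit [:a:]" using a by (simp add: is_unit_triv)
    ultimately have u: "is_unit (lead_coeff G)" "is_unit (lead_coeff H)"
      by (metis is_unit_mult_iff)+
    have "degree G \<noteq> 1" using lin[OF dvdI[OF GH] _ u(1)] by auto
    moreover have "degree H \<noteq> 1"
      using lin[OF dvdI[OF trans[OF GH mult.commute]] _ u(2)] by auto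
    ultimately have "degree G = 0 \<or> degree H = 0" using sum by linarith
    moreover have "is_unit Q" if "degree Q = 0" "is_unit (lead_coeff Q)" for Q :: "rat poly poly"
      using that by (auto elim!: degree_eq_zeroE simp: is_unit_const_poly_iff)
    ultimately show "is_unit G \<or> is_unit H" using u by blast
  qed
qed

lemma irreducible_over_rat_parity:
  fixes a b c d :: int
  assumes "odd a" "even b" "odd c" "odd d"
  shows "irreducible_over_rat (Cubic (of_int a) (of_int b) (of_int c) (of_int d))"
proof -
  have "irreducible (form_poly (Cubic (of_int a :: rat) (of_int b) (of_int c) (of_int d)))"
    using assms cubic_no_rat_root by (intro irreducible_form_poly) auto
  thus ?thesis unfolding irreducible_over_rat_def
    by (intro exI[of _ "Cubic (of_int a) (of_int b) (of_int c) (of_int d)"]) simp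
qed

lemma scale_model:
  assumes "Cubic 1 b c d = model i \<zeta> \<sigma>"
  shows "Cubic a (a * b) (a * c) (a * d) = model i (of_real a * \<zeta>) \<sigma>"
  using assms by (simp add: model_def mult.assoc Re_of_real_mult del: times_complex.sel)

lemma scale_disc:
  assumes "a \<in> {1, -1}"
  shows "disc (Cubic a (a * b) (a * c) (a * d)) = disc (Cubic 1 b c d)"
  using assms by (auto simp: disc_def)

text \<open>For \<open>i = 0\<close> the choice of \<open>d\<close> near \<open>b c / 9\<close>
  makes \<open>b c - 9 d = - 9 m\<close>, and \<open>3 m \<le> \<kappa>\<close> keeps this below the
  Hessian coefficient \<open>b\<^sup>2 + 3 \<kappa>\<close>. For \<open>i = 1\<close> the choice
  near \<open>b c\<close> is the one of \<open>monic_cubic_model_neg\<close>.\<close>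

lemma family_in_gauss_orbit:
  fixes a b \<kappa> m :: real
  assumes \<nu>: "gauss_slices \<nu>" and \<zeta>0: "\<zeta>0 \<noteq> 0" and a: "a \<in> {1, -1}" and i: "i \<in> {0, 1}"
    and b: "b \<ge> 0" and \<kappa>: "\<kappa> \<ge> b + 3" and m: "0 \<le> m" "3 * m \<le> \<kappa>"
  defines "c \<equiv> if i = 0 then - \<kappa> else \<kappa>"
  defines "d \<equiv> if i = 0 then b / 9 * c + m else b * c + m"
  assumes D: "i = 0 \<Longrightarrow> 4 * (b\<^sup>2 + 3 * \<kappa>)\<^sup>2 \<le> 3 * disc (Cubic 1 b c d)"
  shows "Cubic a (a * b) (a * c) (a * d) \<in> (\<lambda>g. act g (model i \<zeta>0 \<i>)) ` gauss_domain \<nu>"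
proof -
  have "\<exists>\<eta> \<sigma>. Cubic 1 b c d = model i (Complex 1 \<eta>) \<sigma> \<and> \<bar>Re \<sigma>\<bar> \<le> 1/2 \<and> Im \<sigma> \<ge> 1"
  proof (cases "i = 0")
    case True
    have eqs: "c = - \<kappa>" "b * c - 9 * d = - 9 * m" "b\<^sup>2 - 3 * c = b\<^sup>2 + 3 * \<kappa>"
      using True by (simp_all add: c_def d_def)
    have "b\<^sup>2 + 3 * \<kappa> > 0" using b \<kappa> by (simp add: add_nonneg_pos)
    moreover have "\<bar>- 9 * m\<bar> \<le> b\<^sup>2 + 3 * \<kappa>" using m by (simp add: add_increasing)
    ultimately show ?thesis
      using monic_cubic_model_pos[of b c d] D True unfolding eqs(2,3) by metis
  next
    case False
    have "m \<le> \<kappa>" using m by simp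
    from monic_cubic_model_neg[OF b \<kappa> m(1) this] False i show ?thesis
      by (simp add: c_def d_def) metis
  qed
  then obtain \<eta> \<sigma> where *: "Cubic 1 b c d = model i (Complex 1 \<eta>) \<sigma>" "\<bar>Re \<sigma>\<bar> \<le> 1/2" "Im \<sigma> \<ge> 1"
    by blast
  have "of_real a * Complex 1 \<eta> \<noteq> 0" using a by (auto simp: complex_eq_iff)
  from model_in_gauss_orbit[OF \<nu> \<zeta>0 this *(2,3)] show ?thesis
    unfolding scale_model[OF *(1)] .
qed

section \<open>Discriminants and size of the family\<close>

text \<open>The term \<open>- 4 c^3\<close> dominates. Every other term contains at least two of the
  factors \<open>b\<close> and \<open>d\<close>, whose bounds carry a factor \<open>\<delta>\<close>
  each; the constants are \<open>675 = 324 + 27 + 324\<close> and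
  \<open>23328 = 4 * 18^3\<close>.\<close>

lemma family_disc_estimate:
  fixes b \<kappa> d s \<delta> H Y :: real
  assumes \<delta>: "0 \<le> \<delta>" "\<delta> \<le> 1" and Y: "Y \<ge> 0" and H: "H \<ge> 0" and b: "0 \<le> b" "b \<le> 18 * \<delta> * Y"
    and \<kappa>: "0 \<le> \<kappa>" "\<kappa> \<le> H * Y\<^sup>2" and d: "\<bar>d\<bar> \<le> \<delta> * H * Y^3" and s: "s \<in> {1, -1}"
  shows "\<bar>disc (Cubic 1 b (s * \<kappa>) d) + s * (4 * \<kappa>^3)\<bar> \<le> \<delta>\<^sup>2 * (675 * H\<^sup>2 + 23328 * H) * Y^6"
proof -
  have 1: "b\<^sup>2 * \<kappa>\<^sup>2 \<le> (18 * \<delta> * Y)\<^sup>2 * (H * Y\<^sup>2)\<^sup>2"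
    using b \<kappa> by (intro mult_mono power_mono) auto
  have 2: "b^3 * \<bar>d\<bar> \<le> (18 * \<delta> * Y)^3 * (\<delta> * H * Y^3)"
    using b d \<delta> Y by (intro mult_mono power_mono) auto
  have 3: "\<bar>d\<bar>\<^sup>2 \<le> (\<delta> * H * Y^3)\<^sup>2"
    using d by (intro power_mono) auto
  have 4: "b * \<kappa> * \<bar>d\<bar> \<le> (18 * \<delta> * Y) * (H * Y\<^sup>2) * (\<delta> * H * Y^3)"
    using b \<kappa> d \<delta> Y by (intro mult_mono) auto
  have \<delta>4: "\<delta>^4 * (H * Y^6) \<le> \<delta>\<^sup>2 * (H * Y^6)"
    using \<delta> Y H power_decreasing[of 2 4 \<delta>] by (intro mult_right_mono) auto
  have "disc (Cubic 1 b (s * \<kappa>) d) + s * (4 * \<kappa>^3)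
      = b\<^sup>2 * \<kappa>\<^sup>2 - 4 * (b^3 * d) - 27 * \<bar>d\<bar>\<^sup>2 + 18 * s * (b * \<kappa> * d)"
    using s by (auto simp: disc_def algebra_simps)
  also have "\<bar>\<dots>\<bar> \<le> b\<^sup>2 * \<kappa>\<^sup>2 + 4 * (b^3 * \<bar>d\<bar>) + 27 * \<bar>d\<bar>\<^sup>2 + 18 * (b * \<kappa> * \<bar>d\<bar>)"
  proof -
    have "\<bar>b\<^sup>2 * \<kappa>\<^sup>2\<bar> = b\<^sup>2 * \<kappa>\<^sup>2" "\<bar>b^3 * d\<bar> = b^3 * \<bar>d\<bar>" "\<bar>\<bar>d\<bar>\<^sup>2\<bar> = \<bar>d\<bar>\<^sup>2"
      "\<bar>s * (b * \<kappa> * d)\<bar> = b * \<kappa> * \<bar>d\<bar>"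
      using b \<kappa> s by (auto simp: abs_mult)
    thus ?thesis by linarith
  qed
  also have "\<dots> \<le> (18 * \<delta> * Y)\<^sup>2 * (H * Y\<^sup>2)\<^sup>2 + 4 * ((18 * \<delta> * Y)^3 * (\<delta> * H * Y^3))
      + 27 * (\<delta> * H * Y^3)\<^sup>2 + 18 * ((18 * \<delta> * Y) * (H * Y\<^sup>2) * (\<delta> * H * Y^3))"
    using 1 2 3 4 by linarith
  also have "\<dots> = \<delta>\<^sup>2 * (675 * H\<^sup>2) * Y^6 + 23328 * (\<delta>^4 * (H * Y^6))"
    by algebra
  also have "\<dots> \<le> \<delta>\<^sup>2 * (675 * H\<^sup>2) * Y^6 + 23328 * (\<delta>\<^sup>2 * (H * Y^6))"
    using \<delta>4 by linarith
  also have "\<dots> = \<delta>\<^sup>2 * (675 * H\<^sup>2 + 23328 * H) * Y^6" by algebra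
  finally show ?thesis .
qed

text \<open>
  The congruences \<open>b \<equiv> 0\<close> and \<open>a \<equiv> c \<equiv> d \<equiv> 1\<close> modulo 2 exclude rational linear factors, since
  \<open>x\<^sup>3 + x + 1\<close> is irreducible over the field with two elements; the factor 18 makes \<open>bc/9\<close> an
  even integer.
\<close>

definition family :: "nat \<Rightarrow> int \<Rightarrow> nat \<Rightarrow> nat \<times> nat \<times> nat \<Rightarrow> real cubic" where
  "family i a K = (\<lambda>(j, k, l).
     let b = 18 * int j; c = (if i = 0 then -1 else 1) * (2 * int (K + k) + 1);
         d = (if i = 0 then 2 else 18) * int j * c + (1 + 2 * int l)
     in Cubic (of_int a) (of_int (a * b)) (of_int (a * c)) (of_int (a * d)))"

lemma inj_family:
  assumes "a \<noteq> 0" shows "inj (family i a K)"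
proof (rule injI)
  fix x y assume "family i a K x = family i a K y"
  moreover obtain j k l j' k' l' where xy: "x = (j, k, l)" "y = (j', k', l')" by (cases x, cases y)
  ultimately have eq: "family i a K (j, k, l) = family i a K (j', k', l')" by simp
  hence j: "j = j'" and k: "k = k'" using assms by (auto simp: family_def Let_def split: if_splits)
  moreover have "l = l'" using eq assms unfolding j k by (auto simp: family_def Let_def split: if_splits)
  ultimately show "x = y" by (simp add: xy)
qed

lemma family_integral_irreducible:
  assumes "a \<in> {1, -1}" and "family i a K x \<in> V_real i"
  shows "family i a K x \<in> V_int_irr i"
proof -
  obtain j k l where x: "x = (j, k, l)" by (cases x)
  have "irreducible_over_rat (family i a K x)"
    unfolding family_def x Let_def prod.case using assms(1)
    by (intro irreducible_over_rat_parity) auto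
  moreover have "{cX3 (family i a K x), cX2Y (family i a K x), cXY2 (family i a K x), cY3 (family i a K x)} \<subseteq> \<int>"
    by (simp only: family_def x Let_def prod.case cubic.sel) simp
  ultimately show ?thesis using assms(2) by (simp add: V_int_irr_def V_int_def)
qed

text \<open>With \<open>Y\<close> playing the role of the sixth root of \<open>X\<close>,
  \<open>\<gamma>\<close> fixes \<open>\<kappa>\<close> near \<open>\<gamma> Y\<^sup>2\<close> and
  the discriminant near \<open>4 \<gamma>^3 Y^6\<close> in absolute value, and
  \<open>\<delta>\<close> keeps the deviation inside the window. The bound on \<open>d\<close>
  yields \<open>H = 18 * (\<gamma> + 3) + 3\<close>.\<close>

lemma family_in_range:
  fixes a :: int and \<gamma> \<delta> Y H M cm cp :: real
  assumes \<nu>: "gauss_slices \<nu>" and \<zeta>0: "\<zeta>0 \<noteq> 0" and a: "a \<in> {1, -1}" and i: "i \<in> {0, 1}"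
    and \<gamma>: "\<gamma> > 0" and \<delta>: "\<delta> > 0" "\<delta> \<le> 1" "9 * \<delta>\<^sup>2 \<le> \<gamma>"
  defines "H \<equiv> 18 * \<gamma> + 57" and "M \<equiv> 675 * H\<^sup>2 + 23328 * H"
  assumes cm: "0 < cm" "cm \<le> 4 * \<gamma>^3 - \<delta>\<^sup>2 * M" and cp: "4 * (\<gamma> + 3 * \<delta>\<^sup>2)^3 + \<delta>\<^sup>2 * M < cp"
    and Y: "2 \<le> \<delta> * Y" "18 * \<delta> * Y + 3 \<le> \<gamma> * Y\<^sup>2" "4 * (324 + 3 * H)\<^sup>2 \<le> 3 * cm * Y\<^sup>2"
    and x: "j < nat \<lfloor>\<delta> * Y\<rfloor>" "k < (nat \<lfloor>\<delta> * Y\<rfloor>)\<^sup>2" "l < (nat \<lfloor>\<delta> * Y\<rfloor>)\<^sup>2"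
  defines "f \<equiv> family i a (nat \<lceil>\<gamma> * Y\<^sup>2 / 2\<rceil>) (j, k, l)"
  shows "f \<in> (\<lambda>g. act g (model i \<zeta>0 \<i>)) ` gauss_domain \<nu>" "f \<in> V_int_irr i" "cX3 f = of_int a"
    "cm * Y^6 \<le> \<bar>disc f\<bar>" "\<bar>disc f\<bar> < cp * Y^6"
proof -
  define K n where "K = nat \<lceil>\<gamma> * Y\<^sup>2 / 2\<rceil>" and "n = nat \<lfloor>\<delta> * Y\<rfloor>"
  define b \<kappa> m s where "b = 18 * real j" and "\<kappa> = 2 * real (K + k) + 1" and "m = 1 + 2 * real l"
    and "s = (if i = 0 then -1 else 1 :: real)"
  define c where "c = (if i = 0 then - \<kappa> else \<kappa>)"
  define d where "d = (if i = 0 then b / 9 * c + m else b * c + m)"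
  have f: "f = Cubic (of_int a) (of_int a * b) (of_int a * c) (of_int a * d)"
    by (simp add: f_def family_def Let_def b_def c_def d_def \<kappa>_def m_def flip: K_def)
  have s: "s \<in> {1, -1}" and c: "c = s * \<kappa>" by (simp_all add: s_def c_def)
  have Y0: "Y > 0" using Y(1) \<delta>(1) by (smt (verit) mult_nonneg_nonpos)
  have n: "real n \<le> \<delta> * Y" using Y(1) by (simp add: n_def)
  have "real (n\<^sup>2) \<le> (\<delta> * Y)\<^sup>2" unfolding of_nat_power using n by (intro power_mono) auto
  hence n2: "real (n\<^sup>2) \<le> \<delta>\<^sup>2 * Y\<^sup>2" by (simp add: power_mult_distrib)
  have "2\<^sup>2 \<le> (\<delta> * Y)\<^sup>2" using Y(1) by (intro power_mono) auto
  hence dY2: "4 \<le> \<delta>\<^sup>2 * Y\<^sup>2" by (simp add: power_mult_distrib)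
  have b: "0 \<le> b" "b \<le> 18 * \<delta> * Y" using x(1) n by (simp_all add: b_def flip: n_def)
  have kl: "real k + 1 \<le> \<delta>\<^sup>2 * Y\<^sup>2" "real l + 1 \<le> \<delta>\<^sup>2 * Y\<^sup>2"
    using x(2,3) n2 unfolding n_def[symmetric] by linarith+
  have m: "0 \<le> m" "m \<le> 3 * (\<delta>\<^sup>2 * Y\<^sup>2)" using kl by (simp_all add: m_def)
  have "\<gamma> * Y\<^sup>2 / 2 \<le> real K" "real K \<le> \<gamma> * Y\<^sup>2 / 2 + 1"
    using \<gamma> by (simp_all add: K_def)
  \<comment> \<open>Two of the three multiples of \<open>\<delta>\<^sup>2 * Y\<^sup>2\<close> bound
    \<open>2 * (k + 1)\<close>; the third covers what remains of the rounding in \<open>K\<close>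
    and the odd shift.\<close>
  hence \<kappa>1: "\<gamma> * Y\<^sup>2 \<le> \<kappa>" and \<kappa>2: "\<kappa> \<le> (\<gamma> + 3 * \<delta>\<^sup>2) * Y\<^sup>2"
    using kl dY2 by (simp_all add: \<kappa>_def algebra_simps)
  have \<delta>2: "\<delta>\<^sup>2 \<le> 1" using \<delta> by (simp add: power_le_one)
  have "(\<gamma> + 3 * \<delta>\<^sup>2) * Y\<^sup>2 \<le> H * Y\<^sup>2"
    using \<delta>2 \<gamma> unfolding H_def by (intro mult_right_mono) auto
  hence \<kappa>3: "\<kappa> \<le> H * Y\<^sup>2" using \<kappa>2 by linarith
  have \<kappa>0: "\<kappa> > 0" by (simp add: \<kappa>_def)
  have d: "\<bar>d\<bar> \<le> \<delta> * H * Y^3"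
  proof -
    have "b * \<kappa> \<ge> 0" using b \<kappa>0 by simp
    moreover have "d = - (b * \<kappa> / 9) + m \<or> d = b * \<kappa> + m" by (simp add: d_def c_def)
    ultimately have "\<bar>d\<bar> \<le> b * \<kappa> + m" using m by linarith
    also have "b * \<kappa> \<le> (18 * \<delta> * Y) * ((\<gamma> + 3 * \<delta>\<^sup>2) * Y\<^sup>2)"
      using b \<kappa>2 \<kappa>0 \<delta>(1) Y0 by (intro mult_mono) auto
    also have "\<dots> \<le> (18 * \<delta> * Y) * ((\<gamma> + 3) * Y\<^sup>2)"
      using \<delta>2 \<delta> Y0 by (intro mult_left_mono mult_right_mono) auto
    also have "m \<le> 3 * (\<delta> * Y^3)"
    proof -
      have "\<delta>\<^sup>2 * Y\<^sup>2 * 1 \<le> \<delta>\<^sup>2 * Y\<^sup>2 * (\<delta> * Y)" using Y(1) by (intro mult_left_mono) auto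
      also have "\<dots> = \<delta>\<^sup>2 * (\<delta> * Y^3)" by algebra
      also have "\<dots> \<le> 1 * (\<delta> * Y^3)" using \<delta>2 \<delta> Y0 by (intro mult_right_mono) auto
      finally show ?thesis using m by linarith
    qed
    finally show ?thesis by (simp add: H_def algebra_simps power2_eq_square power3_eq_cube)
  qed
  have H0: "H \<ge> 0" using \<gamma> by (simp add: H_def)
  have est: "\<bar>disc (Cubic 1 b c d) + s * (4 * \<kappa>^3)\<bar> \<le> \<delta>\<^sup>2 * M * Y^6"
    unfolding c M_def
    by (rule family_disc_estimate[OF _ \<delta>(2) _ H0 b _ \<kappa>3 d s]) (use \<delta> Y0 \<kappa>0 in auto)
  have lo: "4 * \<gamma>^3 * Y^6 \<le> 4 * \<kappa>^3"
  proof -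
    have "(\<gamma> * Y\<^sup>2)^3 \<le> \<kappa>^3" using \<kappa>1 \<gamma> by (intro power_mono) auto
    thus ?thesis by (simp add: power_mult_distrib)
  qed
  have hi: "4 * \<kappa>^3 \<le> 4 * (\<gamma> + 3 * \<delta>\<^sup>2)^3 * Y^6"
  proof -
    have "\<kappa>^3 \<le> ((\<gamma> + 3 * \<delta>\<^sup>2) * Y\<^sup>2)^3" using \<kappa>2 \<kappa>0 by (intro power_mono) auto
    thus ?thesis by (simp add: power_mult_distrib)
  qed
  have "cm * Y^6 \<le> (4 * \<gamma>^3 - \<delta>\<^sup>2 * M) * Y^6" using cm Y0 by (intro mult_right_mono) auto
  moreover have "(4 * (\<gamma> + 3 * \<delta>\<^sup>2)^3 + \<delta>\<^sup>2 * M) * Y^6 < cp * Y^6"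
    using cp Y0 by (intro mult_strict_right_mono) auto
  moreover have "\<bar>disc (Cubic 1 b c d) * s + 4 * \<kappa>^3\<bar> \<le> \<delta>\<^sup>2 * M * Y^6"
    using est s by (auto simp: abs_minus_commute)
  ultimately have D: "cm * Y^6 \<le> - s * disc (Cubic 1 b c d)" "- s * disc (Cubic 1 b c d) < cp * Y^6"
    using lo hi unfolding distrib_right left_diff_distrib by (simp_all add: mult.commute[of s])
  have disc: "disc f = disc (Cubic 1 b c d)" unfolding f by (rule scale_disc) (use a in auto)
  have "cm * Y^6 > 0" using cm Y0 by simp
  hence abs: "\<bar>disc f\<bar> = - s * disc (Cubic 1 b c d)" and sgn: "- s * disc f > 0"
    using D s by (auto simp: disc)
  show "cm * Y^6 \<le> \<bar>disc f\<bar>" "\<bar>disc f\<bar> < cp * Y^6" using D by (simp_all add: abs)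
  show "cX3 f = of_int a" by (simp add: f)
  have "f \<in> V_real i" using sgn i by (auto simp: V_real_def s_def)
  thus "f \<in> V_int_irr i" unfolding f_def by (intro family_integral_irreducible a)
  \<comment> \<open>The left side is of order \<open>Y^4\<close> and the discriminant of order
    \<open>Y^6\<close>, so the last assumption on \<open>Y\<close> decides.\<close>
  have "4 * (b\<^sup>2 + 3 * \<kappa>)\<^sup>2 \<le> 3 * disc (Cubic 1 b c d)" if "i = 0"
  proof -
    have "b\<^sup>2 \<le> (18 * \<delta> * Y)\<^sup>2" using b by (intro power_mono) auto
    also have "\<dots> = 324 * (\<delta>\<^sup>2 * Y\<^sup>2)" by algebra
    also have "\<dots> \<le> 324 * (1 * Y\<^sup>2)" using \<delta>2 by (intro mult_left_mono mult_right_mono) auto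
    finally have "b\<^sup>2 + 3 * \<kappa> \<le> (324 + 3 * H) * Y\<^sup>2" using \<kappa>3 by (simp add: algebra_simps)
    hence "(b\<^sup>2 + 3 * \<kappa>)\<^sup>2 \<le> ((324 + 3 * H) * Y\<^sup>2)\<^sup>2" using \<kappa>0 by (intro power_mono) auto
    hence "4 * (b\<^sup>2 + 3 * \<kappa>)\<^sup>2 \<le> 4 * (324 + 3 * H)\<^sup>2 * Y^4"
      by (simp add: power_mult_distrib)
    also have "\<dots> \<le> 3 * cm * Y\<^sup>2 * Y^4" using Y(3) by (intro mult_right_mono) auto
    also have "\<dots> = 3 * (cm * Y^6)" by algebra
    also have "\<dots> \<le> 3 * disc (Cubic 1 b c d)" using D(1) that by (simp add: s_def)
    finally show ?thesis .
  qed
  moreover have "b + 3 \<le> \<kappa>" using b Y(2) \<kappa>1 by linarith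
  moreover have "3 * m \<le> \<kappa>"
  proof -
    have "9 * \<delta>\<^sup>2 * Y\<^sup>2 \<le> \<gamma> * Y\<^sup>2" using \<delta>(3) by (intro mult_right_mono) auto
    thus ?thesis using m \<kappa>1 by linarith
  qed
  ultimately show "f \<in> (\<lambda>g. act g (model i \<zeta>0 \<i>)) ` gauss_domain \<nu>"
    unfolding f c_def d_def using a
    by (intro family_in_gauss_orbit[OF \<nu> \<zeta>0 _ i b(1) _ m(1)]) auto
qed

text \<open>Taking \<open>4 * \<gamma>^3\<close> at the midpoint of \<open>cm\<close> and
  \<open>cp\<close> makes all conditions strict at \<open>\<delta> = 0\<close>, and continuity keeps
  them for small positive \<open>\<delta>\<close>.\<close>

lemma family_parameter:
  fixes cm cp :: real
  assumes "0 < cm" "cm < cp"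
  obtains \<gamma> \<delta> H M where "\<gamma> > 0" "\<delta> > 0" "\<delta> \<le> 1" "9 * \<delta>\<^sup>2 \<le> \<gamma>"
    "H = 18 * \<gamma> + 57" "M = 675 * H\<^sup>2 + 23328 * H"
    "cm \<le> 4 * \<gamma>^3 - \<delta>\<^sup>2 * M" "4 * (\<gamma> + 3 * \<delta>\<^sup>2)^3 + \<delta>\<^sup>2 * M < cp"
proof -
  define \<gamma> where "\<gamma> = root 3 ((cm + cp) / 8)"
  have \<gamma>: "\<gamma> > 0" "4 * \<gamma>^3 = (cm + cp) / 2" using assms by (simp_all add: \<gamma>_def)
  define H where "H = 18 * \<gamma> + 57"
  define M where "M = 675 * H\<^sup>2 + 23328 * H"
  have "((\<lambda>\<delta>. 4 * \<gamma>^3 - \<delta>\<^sup>2 * M) \<longlongrightarrow> 4 * \<gamma>^3 - 0\<^sup>2 * M) (at_right 0)"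
    "((\<lambda>\<delta>. 4 * (\<gamma> + 3 * \<delta>\<^sup>2)^3 + \<delta>\<^sup>2 * M) \<longlongrightarrow> 4 * (\<gamma> + 3 * 0\<^sup>2)^3 + 0\<^sup>2 * M) (at_right 0)"
    "((\<lambda>\<delta>. 9 * \<delta>\<^sup>2) \<longlongrightarrow> 9 * (0 :: real)\<^sup>2) (at_right 0)"
    by (intro tendsto_intros)+
  moreover have "cm < 4 * \<gamma>^3 - 0\<^sup>2 * M" "4 * (\<gamma> + 3 * 0\<^sup>2)^3 + 0\<^sup>2 * M < cp" "9 * 0\<^sup>2 < \<gamma>"
    using \<gamma> assms by simp_all
  ultimately have "\<forall>\<^sub>F \<delta> in at_right 0. cm < 4 * \<gamma>^3 - \<delta>\<^sup>2 * M"
    "\<forall>\<^sub>F \<delta> in at_right 0. 4 * (\<gamma> + 3 * \<delta>\<^sup>2)^3 + \<delta>\<^sup>2 * M < cp"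
    "\<forall>\<^sub>F \<delta> in at_right 0. 9 * \<delta>\<^sup>2 < \<gamma>"
    by (auto elim: order_tendstoD)
  moreover have "\<forall>\<^sub>F \<delta> in at_right 0. 0 < \<delta> \<and> \<delta> \<le> (1::real)"
    unfolding eventually_at_right_field by (intro exI[of _ 1]) auto
  ultimately have "\<forall>\<^sub>F \<delta> in at_right 0. (cm < 4 * \<gamma>^3 - \<delta>\<^sup>2 * M \<and> 4 * (\<gamma> + 3 * \<delta>\<^sup>2)^3 + \<delta>\<^sup>2 * M < cp)
      \<and> 9 * \<delta>\<^sup>2 < \<gamma> \<and> 0 < \<delta> \<and> \<delta> \<le> 1"
    by eventually_elim blast
  then obtain \<delta> where "cm < 4 * \<gamma>^3 - \<delta>\<^sup>2 * M" "4 * (\<gamma> + 3 * \<delta>\<^sup>2)^3 + \<delta>\<^sup>2 * M < cp"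
    "9 * \<delta>\<^sup>2 < \<gamma>" "0 < \<delta>" "\<delta> \<le> 1"
    using eventually_happens trivial_limit_at_right_real by fastforce
  thus ?thesis using that[OF \<gamma>(1) _ _ _ H_def M_def] by auto
qed

text \<open>With \<open>n\<close> of order \<open>X powr (1/6)\<close>, the index box has
  \<open>n * n\<^sup>2 * n\<^sup>2\<close> points, and injectivity turns them into order
  \<open>X powr (5/6)\<close> distinct forms.\<close>

lemma orbit_form_lower_bound:
  fixes a :: int
  assumes \<nu>: "gauss_slices \<nu>" and \<zeta>: "\<zeta> \<noteq> 0" and a: "a \<in> {1, -1}" and i: "i \<in> {0, 1}"
    and cm: "0 < cm" "cm < cp"
    and fin: "\<And>X. X > 0 \<Longrightarrow> finite ((\<lambda>g. act g (model i \<zeta> \<i>)) ` gauss_domain \<nu> \<inter>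
      {f \<in> V_int_irr i. cX3 f = of_int a \<and> cm * X \<le> \<bar>disc f\<bar> \<and> \<bar>disc f\<bar> < cp * X})"
  obtains \<delta> :: real where "\<delta> > 0" "\<forall>\<^sub>F X in at_top. (\<delta> * X powr (1/6))^5 \<le>
    real (card ((\<lambda>g. act g (model i \<zeta> \<i>)) ` gauss_domain \<nu> \<inter>
      {f \<in> V_int_irr i. cX3 f = of_int a \<and> cm * X \<le> \<bar>disc f\<bar> \<and> \<bar>disc f\<bar> < cp * X}))"
proof -
  obtain \<gamma> \<delta> H M where p: "\<gamma> > 0" "\<delta> > 0" "\<delta> \<le> 1" "9 * \<delta>\<^sup>2 \<le> \<gamma>"
    and H: "H = 18 * \<gamma> + 57" and M: "M = 675 * H\<^sup>2 + 23328 * H"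
    and q: "cm \<le> 4 * \<gamma>^3 - \<delta>\<^sup>2 * M" "4 * (\<gamma> + 3 * \<delta>\<^sup>2)^3 + \<delta>\<^sup>2 * M < cp"
    by (rule family_parameter[OF cm])
  let ?A = "\<lambda>X. (\<lambda>g. act g (model i \<zeta> \<i>)) ` gauss_domain \<nu> \<inter>
      {f \<in> V_int_irr i. cX3 f = of_int a \<and> cm * X \<le> \<bar>disc f\<bar> \<and> \<bar>disc f\<bar> < cp * X}"
  have bound: "(\<delta> / 2 * X powr (1/6))^5 \<le> real (card (?A X))"
    if X: "X > 0" and Y: "2 \<le> \<delta> * X powr (1/6)" "18 * \<delta> * X powr (1/6) + 3 \<le> \<gamma> * (X powr (1/6))\<^sup>2"
      "4 * (324 + 3 * H)\<^sup>2 \<le> 3 * cm * (X powr (1/6))\<^sup>2" for X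
  proof -
    define Y where "Y = X powr (1/6)"
    have XY: "X = Y^6" using X by (simp add: Y_def powr_powr flip: powr_numeral)
    define n where "n = nat \<lfloor>\<delta> * Y\<rfloor>"
    define B where "B = {..<n} \<times> {..<n\<^sup>2} \<times> {..<n\<^sup>2}"
    let ?h = "family i a (nat \<lceil>\<gamma> * Y\<^sup>2 / 2\<rceil>)"
    have "?h ` B \<subseteq> ?A X"
    proof
      fix f assume "f \<in> ?h ` B"
      then obtain j k l where f: "f = ?h (j, k, l)" and jkl: "j < n" "k < n\<^sup>2" "l < n\<^sup>2"
        by (auto simp: B_def)
      note r = family_in_range[OF \<nu> \<zeta> a i p cm(1) q(1)[unfolded M H] q(2)[unfolded M H]
          Y[folded Y_def, unfolded H] jkl[unfolded n_def], folded f XY]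
      show "f \<in> ?A X" using r by simp
    qed
    hence "card (?h ` B) \<le> card (?A X)" by (rule card_mono[OF fin[OF X]])
    moreover have "card (?h ` B) = card B"
      by (rule card_image[OF inj_on_subset[OF inj_family]]) (use a in auto)
    moreover have "card B = n^5"
      by (simp add: B_def card_cartesian_product power_numeral_reduce)
    ultimately have "real n^5 \<le> real (card (?A X))" by (simp flip: of_nat_power)
    \<comment> \<open>As \<open>\<delta> * Y \<ge> 2\<close>, rounding down loses at most
      half.\<close>
    moreover have "\<delta> / 2 * Y \<le> real n" using Y(1)[folded Y_def] unfolding n_def by linarith
    hence "(\<delta> / 2 * Y)^5 \<le> real n^5" using p by (intro power_mono) (auto simp: Y_def)
    ultimately show ?thesis unfolding Y_def by linarith
  qed
  have "\<forall>\<^sub>F X in at_top. X > (0::real)" by (rule eventually_gt_at_top)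
  moreover have "\<forall>\<^sub>F X in at_top. 2 \<le> \<delta> * X powr (1/6)"
    using p(2) by real_asymp
  moreover have "\<forall>\<^sub>F X in at_top. 18 * \<delta> * X powr (1/6) + 3 \<le> \<gamma> * (X powr (1/6))\<^sup>2"
    using p(1,2) by real_asymp
  moreover have "\<forall>\<^sub>F X in at_top. 4 * (324 + 3 * H)\<^sup>2 \<le> 3 * cm * (X powr (1/6))\<^sup>2"
    using cm(1) by real_asymp
  ultimately have "\<forall>\<^sub>F X in at_top. (\<delta> / 2 * X powr (1/6))^5 \<le> real (card (?A X))"
    by eventually_elim (rule bound)
  thus ?thesis using that[of "\<delta> / 2"] p by simp
qed

section \<open>Escape of mass\<close>

theorem theorem2:
  fixes i :: nat and v :: "real cubic" and \<nu> :: "real \<Rightarrow> real set"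
    and \<alpha> cm cp :: real and P :: "real^2"
  assumes "i \<in> {0, 1}"
    and "gauss_slices \<nu>"
    and "v \<in> V_real i" and "shape v = \<i>"
    and "0 < cm" and "cm < cp"
    and "\<alpha> \<in> {1, -1}" and "P = vector [\<alpha>, 0]"
  shows "((\<lambda>T. Liminf at_top (\<lambda>X :: real.
            ereal (real (N_PT \<nu> i v P cm cp T X) / real (N_P \<nu> i v P cm cp X)))) \<longlongrightarrow> 1) at_top"
proof -
  obtain \<zeta> where \<zeta>: "\<zeta> \<noteq> 0" and v: "v = model i \<zeta> \<i>"
    by (rule base_form_model[OF assms(1,3,4)])
  obtain a :: int where a: "a \<in> {1, -1}" "\<alpha> = of_int a"
    using assms(7) by (metis insertE insertI1 insertI2 of_int_1 of_int_minus singletonD)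
  \<comment> \<open>Here \<open>f(P) = \<alpha>^3 * cX3 f\<close> and \<open>\<alpha>\<close> is its
    own inverse.\<close>
  have P: "form_eval f P = 1 \<longleftrightarrow> cX3 f = of_int a" for f
    using a by (auto simp: assms(8) form_eval_def)
  let ?S = "gauss_domain \<nu>"
  define A where "A = (\<lambda>X. {f \<in> V_int_irr i. form_eval f P = 1 \<and> cm * X \<le> \<bar>disc f\<bar> \<and> \<bar>disc f\<bar> < cp * X})"
  have A: "A X = {f \<in> V_int_irr i. cX3 f = of_int a \<and> cm * X \<le> \<bar>disc f\<bar> \<and> \<bar>disc f\<bar> < cp * X}" for X
    by (simp add: A_def P)
  have fin: "finite ((\<lambda>g. act g v) ` ?S \<inter> A X)" if "X > 0" for X
  proof (rule finite_subset)
    show "(\<lambda>g. act g v) ` ?S \<inter> A X \<subseteq> (\<lambda>g. act g v) ` ?S \<inter> {f \<in> V_int_irr i. cX3 f = of_int a \<and> \<bar>disc f\<bar> < cp * X}"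
      unfolding A by blast
    show "finite \<dots>" by (rule gauss_domain_forms_finite[OF assms(2) v]) (use a that assms(5,6) in auto)
  qed
  obtain \<delta> :: real where \<delta>: "\<delta> > 0"
    and lower: "\<forall>\<^sub>F X in at_top. (\<delta> * X powr (1/6))^5 \<le> real (card ((\<lambda>g. act g v) ` ?S \<inter> A X))"
    using orbit_form_lower_bound[OF assms(2) \<zeta> a(1) assms(1,5,6) fin[unfolded A v], folded A v] by blast
  have lim: "((\<lambda>X. real (N_PT \<nu> i v P cm cp T X) / real (N_P \<nu> i v P cm cp X)) \<longlongrightarrow> 1) at_top" for T
  proof -
    define R where "R = 3 * (1 + T\<^sup>2)^3 * (cp / (4 * t0^12)) powr (1/4)"
    have R: "R > 0" using assms(5,6) t0_pos by (auto simp: R_def intro!: mult_pos_pos add_pos_nonneg)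
    have count: "N_PT \<nu> i v P cm cp T X \<le> N_P \<nu> i v P cm cp X"
      "real (N_P \<nu> i v P cm cp X) \<le> real (N_PT \<nu> i v P cm cp T X) + 3 * (2 * (R * X powr (1/4)) + 1)^3"
      "card ((\<lambda>g. act g v) ` ?S \<inter> A X) \<le> N_P \<nu> i v P cm cp X" if X: "X > 0" for X
    proof -
      let ?B = "integral_box (of_int a) (R * X powr (1/4))"
      have sub: "gauss_domain_above \<nu> T \<subseteq> ?S"
        by (auto simp: gauss_domain_above_def gauss_domain_def)
      have fib: "finite {g \<in> ?S. act g v = f} \<and> card {g \<in> ?S. act g v = f} \<le> 3" if "f \<in> A X" for f
        unfolding v using fiber_bound[OF \<zeta>, of f \<nu> i] that a by (auto simp: A)
      have low: "(\<lambda>g. act g v) ` (?S - gauss_domain_above \<nu> T) \<inter> A X \<subseteq> ?B"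
      proof
        fix f assume f: "f \<in> (\<lambda>g. act g v) ` (?S - gauss_domain_above \<nu> T) \<inter> A X"
        then obtain g where g: "g \<in> ?S - gauss_domain_above \<nu> T" "f = act g v" by blast
        have "f \<in> integral_box (of_int a) (3 * (1 + T\<^sup>2)^3 * (cp * X / (4 * t0^12)) powr (1/4))"
          unfolding g(2)
          by (rule gauss_domain_form_bounded_height[OF assms(2) g(1) v]) (use f g(2) in \<open>auto simp: A\<close>)
        also have "3 * (1 + T\<^sup>2)^3 * (cp * X / (4 * t0^12)) powr (1/4) = R * X powr (1/4)"
          using powr_mult[of "cp / (4 * t0^12)" X "1/4"] X assms(5,6) t0_pos by (simp add: R_def)
        finally show "f \<in> ?B" .
      qed
      have B: "finite ?B" "real (card ?B) \<le> (2 * (R * X powr (1/4)) + 1)^3"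
        by (rule integral_box; use R in simp)+
      note diff = form_count_difference[OF sub _ _ fin[OF X, unfolded A_def] low[unfolded A_def] B(1)]
      have fib': "finite {g \<in> ?S. act g v = f}" "card {g \<in> ?S. act g v = f} \<le> 3"
        if "f \<in> {f \<in> V_int_irr i. form_eval f P = 1 \<and> cm * X \<le> \<bar>disc f\<bar> \<and> \<bar>disc f\<bar> < cp * X}" for f
        using fib that unfolding A_def by blast+
      show "N_PT \<nu> i v P cm cp T X \<le> N_P \<nu> i v P cm cp X"
        unfolding N_P_def N_PT_def by (rule diff(1)[OF fib'])
      have "N_P \<nu> i v P cm cp X \<le> N_PT \<nu> i v P cm cp T X + 3 * card ?B"
        unfolding N_P_def N_PT_def by (rule diff(2)[OF fib'])
      hence "real (N_P \<nu> i v P cm cp X) \<le> real (N_PT \<nu> i v P cm cp T X) + 3 * real (card ?B)" by linarith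
      thus "real (N_P \<nu> i v P cm cp X) \<le> real (N_PT \<nu> i v P cm cp T X) + 3 * (2 * (R * X powr (1/4)) + 1)^3"
        using B(2) by linarith
      show "card ((\<lambda>g. act g v) ` ?S \<inter> A X) \<le> N_P \<nu> i v P cm cp X"
        unfolding N_P_def A_def by (rule diff(3)[OF fib'])
    qed
    have ev: "\<forall>\<^sub>F X in at_top.
        1 - 3 * (2 * (R * X powr (1/4)) + 1)^3 / (\<delta> * X powr (1/6))^5
          \<le> real (N_PT \<nu> i v P cm cp T X) / real (N_P \<nu> i v P cm cp X)
        \<and> real (N_PT \<nu> i v P cm cp T X) / real (N_P \<nu> i v P cm cp X) \<le> 1"
      using lower eventually_gt_at_top[of 0]
    proof eventually_elim
      case (elim X)
      define n m E L where "n = real (N_P \<nu> i v P cm cp X)" and "m = real (N_PT \<nu> i v P cm cp T X)"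
        and "E = 3 * (2 * (R * X powr (1/4)) + 1)^3" and "L = (\<delta> * X powr (1/6))^5"
      have "L > 0" using \<delta> elim(2) by (simp add: L_def)
      \<comment> \<open>This also keeps the denominator \<open>n\<close> positive.\<close>
      have "L \<le> n" using elim(1) count(3)[OF elim(2)] unfolding L_def n_def by linarith
      have "E \<ge> 0" using R by (simp add: E_def)
      have mn: "m \<le> n" "n \<le> m + E" using count(1,2)[OF elim(2)] by (simp_all add: m_def n_def E_def)
      have "1 - E / L \<le> 1 - E / n"
        using \<open>L > 0\<close> \<open>L \<le> n\<close> \<open>E \<ge> 0\<close> by (simp add: frac_le)
      also have "\<dots> = (n - E) / n" using \<open>L > 0\<close> \<open>L \<le> n\<close> by (simp add: diff_divide_distrib)
      also have "\<dots> \<le> m / n" using mn \<open>L > 0\<close> \<open>L \<le> n\<close> by (intro divide_right_mono) auto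
      finally have "1 - E / L \<le> m / n" .
      moreover have "m / n \<le> 1" using mn \<open>L > 0\<close> \<open>L \<le> n\<close> by simp
      ultimately show ?case by (simp add: n_def m_def E_def L_def)
    qed
    \<comment> \<open>The error is of order \<open>X powr (3/4)\<close> against
      \<open>X powr (5/6)\<close>.\<close>
    have to_1: "((\<lambda>X. 1 - 3 * (2 * (R * X powr (1/4)) + 1)^3 / (\<delta> * X powr (1/6))^5) \<longlongrightarrow> 1) at_top"
      using \<delta> R by real_asymp
    show ?thesis
      by (rule tendsto_sandwich[OF _ _ to_1 tendsto_const]) (use ev in \<open>auto elim: eventually_mono\<close>)
  qed
  \<comment> \<open>The inner limit is \<open>1\<close> for every \<open>T\<close>, so the outer
    limit is that of a constant.\<close>
  have "Liminf at_top (\<lambda>X. ereal (real (N_PT \<nu> i v P cm cp T X) / real (N_P \<nu> i v P cm cp X))) = 1" for T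
    by (rule lim_imp_Liminf) (use lim[of T] in \<open>simp_all add: one_ereal_def\<close>)
  thus ?thesis by simp
qed

end
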